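(* The generating function $\alpha(x,y,t)=\sum_{n=0}^\infty\sum_{i=1}^n\sum_{j=0}^{n-1}\frac{A(n,i,j)}{j!}x^iy^jt^n$ is given by $$\alpha(x,y,t)=\sum_{j=0}^\infty\frac{y^j}{j!}\sum_{k=0}^j\binom{j}{k}\frac{1}{k+1}\sum_{i=0}^k(-1)^{k-i}\prod_{\ell=0}^i\frac{(x+\ell)(k+1-\ell)t}{1-(x+\ell)(k+1-\ell)t}.$$
   Context: A tournament on $\{1,\ldots,n\}$ has, for each pair $i\ne j$, exactly one of the arcs $i\to j$, $j\to i$; an arc $i\to j$ is an ascent if $i<j$, a descent if $i>j$; alternation acyclic means no directed cycle along which ascents and descents alternate. A parent function is $p:\{1,\ldots,n\}\to\{2,\ldots,n\}\cup\{\infty\}$ with $p(i)>i$. For a permutation $\pi$, $T(\pi,p)$ has, for $u<v$, $u\to v$ if $p(u)\ne\infty$ and $\pi^{-1}(v)\ge\pi^{-1}(p(u))$, else $v\to u$. Right-alternating walk order $\preceq$: $u\preceq v$ if $u=v$ or there is a directed walk from $u$ to $v$ of positive even length alternating descent, ascent, …, ending with an ascent. For alternation acyclic $T$, the largest maximal order $\lambda$ is the permutation with $\lambda(k)$ the largest maximal element of $\{\lambda(1),\ldots,\lambda(k)\}$ under the restriction of $\preceq$ for every $k$; the largest maximal representation is $(\lambda,p)$ with $p$ the unique parent function with $T(\lambda,p)=T$. $T$ has type $(n,i,j)$ if $|p^{-1}(\infty)|=i$ and $|p(\{1,\ldots,n\})|=j+1$ (range including $\infty$); $A(n,i,j)$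 is the number of alternation acyclic tournaments on $\{1,\ldots,n\}$ of type $(n,i,j)$. The identity is one of formal power series. *)

theory Defs
  imports
    Complex_Main
    "HOL-Library.Extended_Nat"
    "HOL-Library.FuncSet"
    "HOL-Combinatorics.Permutations"
    "HOL-Computational_Algebra.Formal_Power_Series"
begin

text \<open>
  A tournament is given by its set of arcs, a pair \<open>(u, v)\<close> standing for \<open>u \<rightarrow> v\<close>.
\<close>

definition tournament :: "nat \<Rightarrow> (nat \<times> nat) set \<Rightarrow> bool" where
  "tournament n T \<longleftrightarrow>
     T \<subseteq> {1..n} \<times> {1..n} \<and> (\<forall>u. (u, u) \<notin> T) \<and>
     (\<forall>u\<in>{1..n}. \<forall>v\<in>{1..n}. u \<noteq> v \<longrightarrow> ((u, v) \<in> T \<longleftrightarrow> (v, u) \<notin> T))"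

definition ascent :: "nat \<Rightarrow> nat \<Rightarrow> bool" where
  "ascent u v \<longleftrightarrow> u < v"

definition descent :: "nat \<Rightarrow> nat \<Rightarrow> bool" where
  "descent u v \<longleftrightarrow> u > v"

text \<open>
  A directed cycle is the list of its (distinct) vertices, read cyclically; the
  alternation is required cyclically, too, i.e. also where the cycle closes up.
\<close>

definition directed_cycle :: "(nat \<times> nat) set \<Rightarrow> nat list \<Rightarrow> bool" where
  "directed_cycle T c \<longleftrightarrow>
     c \<noteq> [] \<and> distinct c \<and> (\<forall>m<length c. (c ! m, c ! (Suc m mod length c)) \<in> T)"

definition alternating_cycle :: "(nat \<times> nat) set \<Rightarrow> nat list \<Rightarrow> bool" where
  "alternating_cycle T c \<longleftrightarrow> directed_cycle T c \<and>
     (\<forall>m<length c.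
        ascent (c ! m) (c ! (Suc m mod length c)) \<longleftrightarrow>
        descent (c ! (Suc m mod length c)) (c ! (Suc (Suc m) mod length c)))"

definition alternation_acyclic :: "(nat \<times> nat) set \<Rightarrow> bool" where
  "alternation_acyclic T \<longleftrightarrow> (\<nexists>c. alternating_cycle T c)"

definition right_alternating_walk :: "(nat \<times> nat) set \<Rightarrow> nat list \<Rightarrow> bool" where
  "right_alternating_walk T w \<longleftrightarrow>
     length w \<ge> 3 \<and> odd (length w) \<and>
     (\<forall>m. Suc m < length w \<longrightarrow>
        (w ! m, w ! Suc m) \<in> T \<and>
        (if even m then descent (w ! m) (w ! Suc m) else ascent (w ! m) (w ! Suc m)))"

definition right_alternating_le :: "(nat \<times> nat) set \<Rightarrow> nat \<Rightarrow> nat \<Rightarrow> bool" where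
  "right_alternating_le T u v \<longleftrightarrow>
     u = v \<or> (\<exists>w. right_alternating_walk T w \<and> hd w = u \<and> last w = v)"

definition maximal_elements :: "(nat \<times> nat) set \<Rightarrow> nat set \<Rightarrow> nat set" where
  "maximal_elements T S = {u\<in>S. \<forall>v\<in>S. right_alternating_le T u v \<longrightarrow> v = u}"

text \<open>
  \<open>\<pi> permutes {1..n}\<close> is the word \<open>\<pi>(1) \<dots> \<pi>(n)\<close>; \<open>\<pi>\<close> is the identity outside \<open>{1..n}\<close>.
\<close>

definition largest_maximal_order :: "nat \<Rightarrow> (nat \<times> nat) set \<Rightarrow> (nat \<Rightarrow> nat) \<Rightarrow> bool" where
  "largest_maximal_order n T \<pi> \<longleftrightarrow> \<pi> permutes {1..n} \<and>
     (\<forall>k\<in>{1..n}.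
        \<pi> k \<in> maximal_elements T (\<pi> ` {1..k}) \<and>
        (\<forall>u\<in>maximal_elements T (\<pi> ` {1..k}). u \<le> \<pi> k))"

text \<open>
  Parent functions are \<open>undefined\<close> outside \<open>{1..n}\<close> (\<open>\<rightarrow>\<^sub>E\<close>), so that
  they are determined by their values on \<open>{1..n}\<close>.
\<close>

definition parent_function :: "nat \<Rightarrow> (nat \<Rightarrow> enat) \<Rightarrow> bool" where
  "parent_function n p \<longleftrightarrow>
     p \<in> {1..n} \<rightarrow>\<^sub>E enat ` {2..n} \<union> {\<infinity>} \<and> (\<forall>u\<in>{1..n}. p u > enat u)"

definition parent_ascent :: "(nat \<Rightarrow> nat) \<Rightarrow> (nat \<Rightarrow> enat) \<Rightarrow> nat \<Rightarrow> nat \<Rightarrow> bool" where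
  "parent_ascent \<pi> p u v \<longleftrightarrow> p u \<noteq> \<infinity> \<and> inv \<pi> v \<ge> inv \<pi> (the_enat (p u))"

definition tournament_of :: "nat \<Rightarrow> (nat \<Rightarrow> nat) \<Rightarrow> (nat \<Rightarrow> enat) \<Rightarrow> (nat \<times> nat) set" where
  "tournament_of n \<pi> p =
     {(u, v). u \<in> {1..n} \<and> v \<in> {1..n} \<and> u < v \<and> parent_ascent \<pi> p u v} \<union>
     {(v, u). u \<in> {1..n} \<and> v \<in> {1..n} \<and> u < v \<and> \<not> parent_ascent \<pi> p u v}"

definition largest_maximal_representation ::
  "nat \<Rightarrow> (nat \<times> nat) set \<Rightarrow> (nat \<Rightarrow> nat) \<Rightarrow> (nat \<Rightarrow> enat) \<Rightarrow> bool" where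
  "largest_maximal_representation n T \<pi> p \<longleftrightarrow>
     largest_maximal_order n T \<pi> \<and> parent_function n p \<and> tournament_of n \<pi> p = T"

definition has_type :: "(nat \<times> nat) set \<Rightarrow> nat \<Rightarrow> nat \<Rightarrow> nat \<Rightarrow> bool" where
  "has_type T n i j \<longleftrightarrow>
     (\<exists>\<pi> p. largest_maximal_representation n T \<pi> p \<and>
        card {u\<in>{1..n}. p u = \<infinity>} = i \<and> card (p ` {1..n}) = j + 1)"

definition type_number :: "nat \<Rightarrow> nat \<Rightarrow> nat \<Rightarrow> nat" where
  "type_number n i j = card {T. tournament n T \<and> alternation_acyclic T \<and> has_type T n i j}"

text \<open>
  The ring of formal power series in \<open>x\<close>, \<open>t\<close>, \<open>y\<close> over the rationals is rendered as
  the iterated power series ring, \<open>x\<close> being the innermost and \<open>y\<close> the outermost variable: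
  the coefficient of \<open>x\<^sup>i y\<^sup>j t\<^sup>n\<close> in \<open>f\<close> is \<open>f $ j $ n $ i\<close>.  The topology
  of the outermost layer is the \<open>y\<close>-adic one: a series converges iff each coefficient
  (in the power series ring in \<open>x\<close> and \<open>t\<close>) of a power of \<open>y\<close> is eventually
  constant along the partial sums.  The library's division \<open>/\<close> by a series with
  zero \<open>y\<close>-subdegree is multiplication by its recursively computed inverse, hence exact
  division by the units \<open>fact j\<close>, \<open>of_nat (k + 1)\<close> and
  \<open>1 - (x + l) (k + 1 - l) t\<close>.
\<close>

type_synonym fps_xty = "rat fps fps fps"

definition var_x :: fps_xty where "var_x = fps_const (fps_const fps_X)"
definition var_t :: fps_xty where "var_t = fps_const fps_X"
definition var_y :: fps_xty where "var_y = fps_X"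

text \<open>
  The range \<open>0 \<le> j \<le> n - 1\<close> of the generating function is written \<open>j < n\<close>, because
  subtraction on \<^typ>\<open>nat\<close> truncates.
\<close>

definition alpha :: fps_xty where
  "alpha = Abs_fps (\<lambda>j. Abs_fps (\<lambda>n. Abs_fps (\<lambda>i.
     if 1 \<le> i \<and> i \<le> n \<and> j < n then of_nat (type_number n i j) / fact j else 0)))"

end

theory Submission
  imports Defs
begin

text \<open>
  A pair \<open>(\<lambda>, p)\<close> is the largest maximal representation of \<open>T(\<lambda>, p)\<close> exactly when every descent
  bottom of \<open>\<lambda>\<close> is a value of \<open>p\<close>, so \<open>A(n, i, j)\<close> counts such pairs.  Inserting the letters in
  increasing order shows that the number of permutations whose descent bottoms lie in \<open>R\<close> is
  \<open>\<Prod>v\<le>n. 1 + card (R \<inter> {1..<v})\<close>.  Removing the vertex \<open>n\<close>, which either is no parent or is the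
  parent of a nonempty set of roots of the smaller forest, yields for
  \<open>B n j x = \<Sum>i. A(n, i, j) x^i\<close> the recurrence
  \<open>B n j x = x ((j + 1) B (n-1) j x + j (B (n-1) (j-1) (x+1) - B (n-1) (j-1) x))\<close>.
  The inner alternating sum \<open>G k x\<close> of the claimed formula, divided by \<open>k + 1\<close>, satisfies
  \<open>G k x (1 - (k+1) x t) = x t (k G (k-1) (x+1) + (-1)^k)\<close>, and its binomial transform therefore
  satisfies the recurrence of the series \<open>\<Sum>n\<ge>1. B n j x t^n\<close>.
\<close>

unbundle fps_syntax

subsection \<open>Largest maximal representations\<close>

lemma tournament_of_iff:
  assumes "u \<in> {1..n}" "v \<in> {1..n}" "u < v"
  shows "(u, v) \<in> tournament_of n \<pi> p \<longleftrightarrow> parent_ascent \<pi> p u v"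
    and "(v, u) \<in> tournament_of n \<pi> p \<longleftrightarrow> \<not> parent_ascent \<pi> p u v"
  using assms unfolding tournament_of_def by auto

lemma tournament_of_vertices:
  assumes "(u, v) \<in> tournament_of n \<pi> p"
  shows "u \<in> {1..n}" "v \<in> {1..n}" "u \<noteq> v"
  using assms unfolding tournament_of_def by auto

lemma tournament_tournament_of: "tournament n (tournament_of n \<pi> p)"
  unfolding tournament_def
proof (intro conjI ballI impI allI subsetI)
  fix u v assume uv: "u \<in> {1..n}" "v \<in> {1..n}" "u \<noteq> v"
  show "(u, v) \<in> tournament_of n \<pi> p \<longleftrightarrow> (v, u) \<notin> tournament_of n \<pi> p"
  proof (cases "u < v")
    case True
    then show ?thesis using tournament_of_iff[OF uv(1,2) True] by simp
  next
    case False
    then have "v < u" using uv(3) by simp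
    then show ?thesis using tournament_of_iff[OF uv(2,1)] by simp
  qed
next
  fix e assume "e \<in> tournament_of n \<pi> p"
  then show "e \<in> {1..n} \<times> {1..n}"
    by (cases e) (auto dest: tournament_of_vertices)
next
  fix u show "(u, u) \<notin> tournament_of n \<pi> p"
    using tournament_of_vertices(3) by blast
qed

text \<open>The ascents out of \<open>b\<close> go exactly to the larger vertices at or after
  \<open>p b\<close> in \<pi>. So the parent of \<open>b\<close> separates the source of a descent
  into \<open>b\<close> from the target of an ascent out of \<open>b\<close>.\<close>

lemma descent_ascent_position:
  assumes "(a, b) \<in> tournament_of n \<pi> p" "a > b"
    and "(b, c) \<in> tournament_of n \<pi> p" "b < c"
  shows "inv \<pi> a < inv \<pi> (the_enat (p b))" and "inv \<pi> (the_enat (p b)) \<le> inv \<pi> c"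
    and "p b \<noteq> \<infinity>"
proof -
  have "\<not> parent_ascent \<pi> p b a"
    using tournament_of_iff(2)[of b n a] tournament_of_vertices[OF assms(1)] assms by blast
  moreover have "parent_ascent \<pi> p b c"
    using tournament_of_iff(1)[of b n c] tournament_of_vertices[OF assms(3)] assms by blast
  ultimately show "inv \<pi> a < inv \<pi> (the_enat (p b))" "inv \<pi> (the_enat (p b)) \<le> inv \<pi> c" "p b \<noteq> \<infinity>"
    unfolding parent_ascent_def by auto
qed

text \<open>On an alternating cycle every second vertex moves strictly forward in \<pi>, which is
  impossible on returning to the start.\<close>

lemma alternation_acyclic_tournament_of: "alternation_acyclic (tournament_of n \<pi> p)"
  unfolding alternation_acyclic_def
proof
  let ?T = "tournament_of n \<pi> p"
  assume "\<exists>c. alternating_cycle ?T c"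
  then obtain c where c: "alternating_cycle ?T c" ..
  define L where "L = length c"
  define s where "s m = c ! (m mod L)" for m
  have L: "L > 0"
    using c by (simp add: alternating_cycle_def directed_cycle_def L_def)
  have arc: "(s m, s (Suc m)) \<in> ?T" for m
  proof -
    have "(c ! (m mod L), c ! (Suc (m mod L) mod L)) \<in> ?T"
      using c L unfolding alternating_cycle_def directed_cycle_def L_def by simp
    then show ?thesis by (simp add: s_def mod_Suc_eq)
  qed
  have alt: "s m < s (Suc m) \<longleftrightarrow> s (Suc m) > s (Suc (Suc m))" for m
  proof -
    have "c ! (m mod L) < c ! (Suc (m mod L) mod L) \<longleftrightarrow>
        c ! (Suc (m mod L) mod L) > c ! (Suc (Suc (m mod L)) mod L)"
      using c L unfolding alternating_cycle_def L_def ascent_def descent_def by simp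
    moreover have "Suc (Suc (m mod L)) mod L = Suc (Suc m) mod L"
      by (metis mod_Suc_eq)
    ultimately show ?thesis by (simp add: s_def mod_Suc_eq)
  qed
  have ne: "s m \<noteq> s (Suc m)" for m
    using tournament_of_vertices(3)[OF arc] .
  have "s (Suc 0) < s 0 \<or> s (Suc (Suc 0)) < s (Suc 0)"
    using alt[of 0] ne[of 0] by linarith
  then obtain m0 where m0: "s (Suc m0) < s m0"
    by blast
  \<comment> \<open>From a descent at \<open>m0\<close> on, alternation puts a descent at each even
    offset and an ascent at each odd one.\<close>
  have down: "s (Suc (m0 + 2 * i)) < s (m0 + 2 * i) \<and>
      s (Suc (m0 + 2 * i)) < s (Suc (Suc (m0 + 2 * i)))" for i
  proof (induction i)
    case 0
    then show ?case using m0 alt[of m0] ne[of "Suc m0"] by auto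
  next
    case (Suc i)
    let ?m = "m0 + 2 * i"
    have "s (Suc (Suc (Suc ?m))) < s (Suc (Suc ?m))"
      using Suc alt[of "Suc ?m"] by blast
    moreover from this have "s (Suc (Suc (Suc ?m))) < s (Suc (Suc (Suc (Suc ?m))))"
      using alt[of "Suc (Suc ?m)"] ne[of "Suc (Suc (Suc ?m))"] by auto
    ultimately show ?case by simp
  qed
  have "strict_mono (\<lambda>i. inv \<pi> (s (m0 + 2 * i)))"
  proof (rule strict_mono_Suc_iff[THEN iffD2], rule allI)
    fix i
    have "inv \<pi> (s (m0 + 2 * i)) < inv \<pi> (s (Suc (Suc (m0 + 2 * i))))"
      using descent_ascent_position(1,2)[OF arc _ arc, of "m0 + 2 * i"] down[of i]
      by (meson less_le_trans)
    then show "inv \<pi> (s (m0 + 2 * i)) < inv \<pi> (s (m0 + 2 * Suc i))" by simp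
  qed
  \<comment> \<open>After \<open>2 * L\<close> steps the cycle is back at its start, whatever the
    parity of \<open>L\<close>.\<close>
  then have "inv \<pi> (s (m0 + 2 * 0)) < inv \<pi> (s (m0 + 2 * L))"
    using L by (rule strict_monoD)
  then show False by (simp add: s_def)
qed

section \<open>Walk order and positions\<close>

lemma right_alternating_walk_position:
  assumes w: "right_alternating_walk (tournament_of n \<pi> p) w"
    and "i < m" "2 * m < length w"
  shows "inv \<pi> (w ! (2 * i)) < inv \<pi> (w ! (2 * m))"
  using assms(2,3)
proof (induction m)
  case (Suc m)
  have step: "(w ! k, w ! Suc k) \<in> tournament_of n \<pi> p \<and>
      (if even k then descent (w ! k) (w ! Suc k) else ascent (w ! k) (w ! Suc k))"
    if "Suc k < length w" for k
    using w that unfolding right_alternating_walk_def by blast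
  have "inv \<pi> (w ! (2 * m)) < inv \<pi> (w ! Suc (Suc (2 * m)))"
    using step[of "2 * m"] step[of "Suc (2 * m)"] Suc.prems(2)
      descent_ascent_position(1,2)[of "w ! (2 * m)" "w ! Suc (2 * m)" n \<pi> p "w ! Suc (Suc (2 * m))"]
    by (simp add: descent_def ascent_def)
  then have "inv \<pi> (w ! (2 * m)) < inv \<pi> (w ! (2 * Suc m))" by simp
  moreover have "i = m \<or> inv \<pi> (w ! (2 * i)) < inv \<pi> (w ! (2 * m))"
    using Suc by (cases "i = m") auto
  ultimately show ?case by (auto intro: less_trans)
qed simp

lemma right_alternating_walk_hd_last:
  assumes "right_alternating_walk T w"
  shows "hd w = w ! 0" "last w = w ! (2 * (length w div 2))"
    "2 * (length w div 2) < length w" "1 \<le> length w div 2"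
proof -
  have l: "length w \<ge> 3" "odd (length w)"
    using assms unfolding right_alternating_walk_def by auto
  then have ne: "w \<noteq> []" by auto
  show "hd w = w ! 0" using ne by (rule hd_conv_nth)
  have "2 * (length w div 2) = length w - 1"
    using l(2) by (rule odd_two_times_div_two_nat)
  then show "last w = w ! (2 * (length w div 2))"
    using last_conv_nth[OF ne] by simp
  show "2 * (length w div 2) < length w" "1 \<le> length w div 2"
    using l by (simp_all add: odd_two_times_div_two_nat)
qed

text \<open>A walk is a chain of descent-ascent pairs, each moving forward in \<pi>, so \<pi> lists
  the vertices compatibly with the walk order.\<close>

lemma right_alternating_le_position:
  assumes "right_alternating_le (tournament_of n \<pi> p) u v"
  shows "inv \<pi> u \<le> inv \<pi> v"
proof (cases "u = v")
  case False
  then obtain w where w: "right_alternating_walk (tournament_of n \<pi> p) w" "hd w = u" "last w = v"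
    using assms unfolding right_alternating_le_def by blast
  show ?thesis
    using right_alternating_walk_position[OF w(1), of 0 "length w div 2"]
      right_alternating_walk_hd_last[OF w(1)] w(2,3) by simp
qed simp

section \<open>Characterization of largest maximal orders by descent bottoms\<close>

definition descent_bottoms_in :: "nat \<Rightarrow> (nat \<Rightarrow> nat) \<Rightarrow> nat set \<Rightarrow> bool" where
  "descent_bottoms_in n \<pi> R \<longleftrightarrow> (\<forall>k\<in>{1..<n}. \<pi> k > \<pi> (k + 1) \<longrightarrow> \<pi> (k + 1) \<in> R)"

lemma right_alternating_le_two_step:
  assumes "(a, b) \<in> T" "a > b" "(b, c) \<in> T" "b < c"
  shows "right_alternating_le T a c"
proof -
  have "right_alternating_walk T [a, b, c]"
    unfolding right_alternating_walk_def
  proof (intro conjI allI impI)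
    fix m assume "Suc m < length [a, b, c]"
    then consider "m = 0" | "m = 1" by fastforce
    then show "([a, b, c] ! m, [a, b, c] ! Suc m) \<in> T"
      "if even m then descent ([a, b, c] ! m) ([a, b, c] ! Suc m)
       else ascent ([a, b, c] ! m) ([a, b, c] ! Suc m)"
      using assms by (cases; simp add: descent_def ascent_def)+
  qed simp_all
  then show ?thesis
    unfolding right_alternating_le_def by (metis last.simps list.distinct(1) list.sel(1))
qed

text \<open>Suppose a letter \<open>u\<close> before position \<open>k\<close>, larger than
  \<open>\<pi> k\<close>, were maximal. The first letter after \<open>u\<close> that is smaller than
  \<open>u\<close> is a descent bottom, hence the parent of some \<open>b\<close>; the arcs from
  \<open>u\<close> to \<open>b\<close> and from \<open>b\<close> to that letter contradict
  maximality.\<close>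

lemma largest_maximal_orderI:
  assumes perm: "\<pi> permutes {1..n}" and p: "parent_function n p"
    and desc: "descent_bottoms_in n \<pi> {v. enat v \<in> p ` {1..n}}"
  shows "largest_maximal_order n (tournament_of n \<pi> p) \<pi>"
  unfolding largest_maximal_order_def
proof (intro conjI ballI perm)
  let ?T = "tournament_of n \<pi> p"
  fix k assume k: "k \<in> {1..n}"
  show "\<pi> k \<in> maximal_elements ?T (\<pi> ` {1..k})"
    unfolding maximal_elements_def
  proof (intro CollectI conjI ballI impI)
    show "\<pi> k \<in> \<pi> ` {1..k}" using k by simp
    fix v assume "v \<in> \<pi> ` {1..k}" and le: "right_alternating_le ?T (\<pi> k) v"
    then obtain m where m: "m \<in> {1..k}" "v = \<pi> m" by blast
    then have "k \<le> m"
      using right_alternating_le_position[OF le] by (simp add: permutes_inverses(2)[OF perm])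
    then show "v = \<pi> k" using m by simp
  qed
  fix u assume u: "u \<in> maximal_elements ?T (\<pi> ` {1..k})"
  show "u \<le> \<pi> k"
  proof (rule ccontr)
    assume less: "\<not> u \<le> \<pi> k"
    have "u \<in> \<pi> ` {1..k}"
      using u by (simp add: maximal_elements_def)
    then obtain m where m: "m \<in> {1..k}" "u = \<pi> m"
      by blast
    have "m \<noteq> k"
    proof
      assume "m = k"
      then have "u = \<pi> k" using m(2) by simp
      then show False using less by simp
    qed
    then have mk: "m < k \<and> \<pi> k < u"
      using m(1) less by simp
    \<comment> \<open>The first position after that of \<open>u\<close> with a letter below
      \<open>u\<close>. The letter just before it is at least \<open>u\<close>, which makes
      \<open>\<pi> m'\<close> a descent bottom.\<close>
    define m' where "m' = (LEAST i. m < i \<and> \<pi> i < u)"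
    have "m < m' \<and> \<pi> m' < u"
      unfolding m'_def by (rule LeastI[where P = "\<lambda>i. m < i \<and> \<pi> i < u", OF mk])
    then have m': "m < m'" "\<pi> m' < u" by simp_all
    have m'k: "m' \<le> k"
      unfolding m'_def by (rule Least_le[where P = "\<lambda>i. m < i \<and> \<pi> i < u", OF mk])
    have prev: "u \<le> \<pi> (m' - 1)"
    proof (cases "m' - 1 = m")
      case True
      then show ?thesis by (simp only: m(2))
    next
      case False
      then have "m < m' - 1" "m' - 1 < m'" using m'(1) by linarith+
      from not_less_Least[OF this(2)[unfolded m'_def], folded m'_def] this(1)
      show ?thesis by (simp only: simp_thms not_less)
    qed
    have "1 \<le> m" "m' \<le> n"
      using m(1) m'k k by simp_all
    then have "1 \<le> m' - 1 \<and> m' - 1 < n" and Suc: "m' - 1 + 1 = m'"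
      using m'(1) by linarith+
    then have "m' - 1 \<in> {1..<n}" by simp
    then have "\<pi> (m' - 1) > \<pi> (m' - 1 + 1) \<longrightarrow> \<pi> (m' - 1 + 1) \<in> {v. enat v \<in> p ` {1..n}}"
      by (rule bspec[OF desc[unfolded descent_bottoms_in_def]])
    then have "\<pi> m' < \<pi> (m' - 1) \<longrightarrow> enat (\<pi> m') \<in> p ` {1..n}"
      unfolding Suc mem_Collect_eq .
    moreover have "\<pi> m' < \<pi> (m' - 1)"
      using prev m'(2) by (rule less_le_trans[rotated])
    ultimately have "enat (\<pi> m') \<in> p ` {1..n}" by (rule mp)
    then obtain b where b: "b \<in> {1..n}" "p b = enat (\<pi> m')"
      by fastforce
    have "enat b < p b"
      using p b(1) unfolding parent_function_def by blast
    then have "b < \<pi> m'"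
      by (simp add: b(2))
    moreover have in_n: "\<pi> m' \<in> {1..n}" "u \<in> {1..n}"
      using permutes_in_image[OF perm, of m'] permutes_in_image[OF perm, of m] m' m'k m k by simp_all
    moreover have "parent_ascent \<pi> p b (\<pi> m')"
      by (simp add: parent_ascent_def b(2))
    moreover have "\<not> parent_ascent \<pi> p b u"
      using m' by (simp add: parent_ascent_def b(2) m(2) permutes_inverses(2)[OF perm])
    ultimately have "(b, \<pi> m') \<in> ?T" "(u, b) \<in> ?T"
      using tournament_of_iff(1)[OF b(1) in_n(1)] tournament_of_iff(2)[OF b(1) in_n(2)] m'
      by auto
    then have "right_alternating_le ?T u (\<pi> m')"
      using right_alternating_le_two_step \<open>b < \<pi> m'\<close> m' less_trans by blast
    moreover have "\<pi> m' \<in> \<pi> ` {1..k}"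
      using m' m'k by simp
    ultimately have "\<pi> m' = u"
      using u unfolding maximal_elements_def by blast
    then show False using m' by simp
  qed
qed

text \<open>If \<open>\<pi> k > \<pi> (k + 1)\<close>, then \<open>\<pi> k\<close> is not maximal
  among the first \<open>k + 1\<close> letters. A walk from it to another of these letters first
  descends to a vertex whose parent must stand after position \<open>k\<close> and no later than
  \<open>k + 1\<close>.\<close>

lemma largest_maximal_orderD:
  assumes p: "parent_function n p"
    and lmo: "largest_maximal_order n (tournament_of n \<pi> p) \<pi>"
  shows "descent_bottoms_in n \<pi> {v. enat v \<in> p ` {1..n}}"
  unfolding descent_bottoms_in_def
proof (intro ballI impI)
  let ?T = "tournament_of n \<pi> p"
  fix k assume k: "k \<in> {1..<n}" and desc: "\<pi> (k + 1) < \<pi> k"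
  have perm: "\<pi> permutes {1..n}"
    using lmo by (simp add: largest_maximal_order_def)
  have "\<forall>u\<in>maximal_elements ?T (\<pi> ` {1..k + 1}). u \<le> \<pi> (k + 1)"
    using lmo k unfolding largest_maximal_order_def by auto
  then have "\<pi> k \<notin> maximal_elements ?T (\<pi> ` {1..k + 1})"
    using desc by (meson not_le)
  moreover have "\<pi> k \<in> \<pi> ` {1..k + 1}" using k by auto
  ultimately obtain v where v: "v \<in> \<pi> ` {1..k + 1}" "right_alternating_le ?T (\<pi> k) v" "v \<noteq> \<pi> k"
    unfolding maximal_elements_def by blast
  then obtain i where i: "i \<in> {1..k + 1}" "v = \<pi> i" by blast
  obtain w where w: "right_alternating_walk ?T w" "hd w = \<pi> k" "last w = v"
    using v(2,3) unfolding right_alternating_le_def by metis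
  define l where "l = length w div 2"
  note hl = right_alternating_walk_hd_last[OF w(1), folded l_def]
  have len: "2 < length w" using hl(3,4) by simp
  \<comment> \<open>The first descent and ascent of the walk locate the parent; the rest of the walk
    only moves forward, so its end bounds the position of \<open>w ! 2\<close>.\<close>
  have two: "inv \<pi> (w ! 2) \<le> inv \<pi> (w ! (2 * l))"
    using right_alternating_walk_position[OF w(1), of 1 l] hl by (cases "l = 1") auto
  have arcs: "(w ! 0, w ! 1) \<in> ?T" "w ! 0 > w ! 1" "(w ! 1, w ! 2) \<in> ?T" "w ! 1 < w ! 2"
  proof -
    have *: "(w ! m, w ! Suc m) \<in> ?T \<and>
        (if even m then descent (w ! m) (w ! Suc m) else ascent (w ! m) (w ! Suc m))"
      if "Suc m < length w" for m
      using w(1) that unfolding right_alternating_walk_def by blast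
    show "(w ! 0, w ! 1) \<in> ?T" "w ! 0 > w ! 1" "(w ! 1, w ! 2) \<in> ?T" "w ! 1 < w ! 2"
      using *[of 0] *[of 1] len by (simp_all add: descent_def ascent_def numeral_2_eq_2)
  qed
  note pos = descent_ascent_position[OF arcs]
  have "inv \<pi> (w ! 0) = k"
    using hl(1) w(2) permutes_inverses(2)[OF perm] by metis
  moreover have "inv \<pi> (w ! (2 * l)) = i"
    using hl(2) w(3) i(2) permutes_inverses(2)[OF perm] by metis
  ultimately have "k < inv \<pi> (the_enat (p (w ! 1)))" "inv \<pi> (the_enat (p (w ! 1))) \<le> k + 1"
    using pos(1,2) two i(1) by auto
  then have "inv \<pi> (the_enat (p (w ! 1))) = k + 1" by simp
  then have "the_enat (p (w ! 1)) = \<pi> (k + 1)"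
    using permutes_inverses(1)[OF perm] by metis
  then have "p (w ! 1) = enat (\<pi> (k + 1))"
    using pos(3) by (cases "p (w ! 1)") auto
  moreover have "w ! 1 \<in> {1..n}"
    using tournament_of_vertices(2)[OF arcs(1)] .
  ultimately show "\<pi> (k + 1) \<in> {v. enat v \<in> p ` {1..n}}"
    by (metis (mono_tags, lifting) image_eqI mem_Collect_eq)
qed

section \<open>Uniqueness of the representation\<close>

text \<open>The order is recovered from the right: the letters after position \<open>k\<close>
  determine the set of the first \<open>k\<close> letters, whose largest maximal element is the
  letter at \<open>k\<close>.\<close>

lemma largest_maximal_order_unique:
  assumes "largest_maximal_order n T \<pi>" "largest_maximal_order n T \<sigma>"
  shows "\<pi> = \<sigma>"
proof -
  have perm: "\<pi> permutes {1..n}" "\<sigma> permutes {1..n}"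
    using assms by (auto simp: largest_maximal_order_def)
  have image: "\<tau> ` {1..k} = {1..n} - \<tau> ` {k<..n}" if "\<tau> permutes {1..n}" "k \<le> n" for \<tau> k
  proof -
    have "{1..k} = {1..n} - {k<..n}" using that(2) by auto
    then have "\<tau> ` {1..k} = \<tau> ` ({1..n} - {k<..n})" by (rule arg_cong)
    also have "\<dots> = \<tau> ` {1..n} - \<tau> ` {k<..n}"
      by (rule image_set_diff[OF permutes_inj[OF that(1)]])
    finally show ?thesis unfolding permutes_image[OF that(1)] .
  qed
  have *: "\<pi> k = \<sigma> k" if "k \<in> {1..n}" for k
    using that
  proof (induction "n - k" arbitrary: k rule: less_induct)
    case less
    have "\<pi> i = \<sigma> i" if "i \<in> {k<..n}" for i
      using less(1)[of i] that less(2) by auto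
    then have "\<pi> ` {k<..n} = \<sigma> ` {k<..n}" by (intro image_cong refl)
    then have eq: "\<pi> ` {1..k} = \<sigma> ` {1..k}"
      using image[OF perm(1), of k] image[OF perm(2), of k] less(2) by simp
    have "\<pi> k \<in> maximal_elements T (\<pi> ` {1..k})" "\<forall>u\<in>maximal_elements T (\<pi> ` {1..k}). u \<le> \<pi> k"
      "\<sigma> k \<in> maximal_elements T (\<sigma> ` {1..k})" "\<forall>u\<in>maximal_elements T (\<sigma> ` {1..k}). u \<le> \<sigma> k"
      using assms less(2) unfolding largest_maximal_order_def by blast+
    then show ?case unfolding eq by (intro antisym) simp_all
  qed
  show ?thesis
  proof
    fix k show "\<pi> k = \<sigma> k"
      using *[of k] permutes_not_in[OF perm(1), of k] permutes_not_in[OF perm(2), of k]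
      by (cases "k \<in> {1..n}") simp_all
  qed
qed

text \<open>\<open>p u\<close> is the earliest vertex in \<pi> among the targets of ascents out of
  \<open>u\<close>, and infinite if there are none; the tournament determines it.\<close>

lemma parent_function_eqI:
  assumes perm: "\<pi> permutes {1..n}"
    and p: "parent_function n p" and q: "parent_function n q"
    and eq: "tournament_of n \<pi> p = tournament_of n \<pi> q"
  shows "p = q"
proof -
  \<comment> \<open>The arc from \<open>u\<close> to \<open>r u\<close> is an ascent for
    \<open>r'\<close> as well, so \<open>r' u\<close> stands no later than \<open>r u\<close>. Used
    in both directions, this puts both parents at the same position.\<close>
  have bound: "\<exists>v'. r' u = enat v' \<and> inv \<pi> v' \<le> inv \<pi> v"
    if "parent_function n r" "tournament_of n \<pi> r = tournament_of n \<pi> r'"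
      "u \<in> {1..n}" "r u = enat v" for r r' u v
  proof -
    have "r u \<in> enat ` {2..n} \<union> {\<infinity>}" "r u > enat u"
      using that(1) PiE_mem[OF _ that(3)] that(3) unfolding parent_function_def by blast+
    then have v: "v \<in> {1..n}" "u < v" unfolding that(4) by auto
    have "parent_ascent \<pi> r u v" by (simp add: parent_ascent_def that(4))
    then have "parent_ascent \<pi> r' u v"
      using tournament_of_iff(1)[OF that(3) v, of \<pi> r]
        tournament_of_iff(1)[OF that(3) v, of \<pi> r'] that(2) by simp
    then show ?thesis
      unfolding parent_ascent_def by (cases "r' u") auto
  qed
  have "p u = q u" if u: "u \<in> {1..n}" for u
  proof (cases "p u")
    case (enat v)
    obtain v' where v': "q u = enat v'" "inv \<pi> v' \<le> inv \<pi> v"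
      using bound[OF p eq u enat] by blast
    obtain v'' where "p u = enat v''" "inv \<pi> v'' \<le> inv \<pi> v'"
      using bound[OF q eq[symmetric] u v'(1)] by blast
    then have "inv \<pi> v = inv \<pi> v'" using enat v'(2) by simp
    then have "v = v'" using permutes_inverses(1)[OF perm] by metis
    then show ?thesis using enat v'(1) by simp
  next
    case infinity
    show ?thesis
    proof (cases "q u")
      case (enat v)
      then show ?thesis using bound[OF q eq[symmetric] u enat] infinity by simp
    qed (simp add: infinity)
  qed
  moreover have "p \<in> {1..n} \<rightarrow>\<^sub>E enat ` {2..n} \<union> {\<infinity>}" "q \<in> {1..n} \<rightarrow>\<^sub>E enat ` {2..n} \<union> {\<infinity>}"
    using p q unfolding parent_function_def by blast+
  ultimately show ?thesis
    by (intro PiE_ext) blast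
qed

lemma largest_maximal_representation_iff:
  "largest_maximal_representation n (tournament_of n \<pi> p) \<pi> p \<longleftrightarrow>
     \<pi> permutes {1..n} \<and> parent_function n p \<and> descent_bottoms_in n \<pi> {v. enat v \<in> p ` {1..n}}"
  using largest_maximal_orderI largest_maximal_orderD
  unfolding largest_maximal_representation_def largest_maximal_order_def by blast

lemma largest_maximal_representation_unique:
  assumes "largest_maximal_representation n T \<pi> p" "largest_maximal_representation n T \<sigma> q"
  shows "\<pi> = \<sigma> \<and> p = q"
proof -
  have "\<pi> = \<sigma>"
    using assms largest_maximal_order_unique unfolding largest_maximal_representation_def by blast
  moreover have "p = q"
    using assms calculation
    unfolding largest_maximal_representation_def largest_maximal_order_def
    by (intro parent_function_eqI[of \<pi> n p q]) auto
  ultimately show ?thesis ..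
qed

subsection \<open>Permutations with prescribed descent bottoms\<close>

text \<open>One-line words of permutations, kept as lists because letters are to be
  inserted.\<close>

definition descent_lists :: "nat \<Rightarrow> nat set \<Rightarrow> nat list set" where
  "descent_lists n R =
     {xs. distinct xs \<and> set xs = {1..n} \<and> successively (\<lambda>a b. a < b \<or> b \<in> R) xs}"

definition descent_perms :: "nat \<Rightarrow> nat set \<Rightarrow> (nat \<Rightarrow> nat) set" where
  "descent_perms n R = {\<pi>. \<pi> permutes {1..n} \<and> descent_bottoms_in n \<pi> R}"

text \<open>The factor for \<open>v\<close> counts the slots open to \<open>v\<close> when letters
  are inserted in increasing order: the end of the word, or directly before an element of
  \<open>R\<close> below \<open>v\<close>.\<close>

definition weight :: "nat \<Rightarrow> nat set \<Rightarrow> nat" where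
  "weight n R = (\<Prod>v=1..n. 1 + card (R \<inter> {1..<v}))"

lemma descent_lists_0: "descent_lists 0 R = {[]}"
  by (auto simp: descent_lists_def)

text \<open>
  The new maximum may precede an element of \<open>R\<close> or stand at the end; the latter is encoded by
  \<open>b = 0\<close>, which does not occur in the list.
\<close>

lemma descent_lists_Suc:
  "bij_betw (\<lambda>(xs, b). takeWhile (\<lambda>a. a \<noteq> b) xs @ Suc n # dropWhile (\<lambda>a. a \<noteq> b) xs)
     (descent_lists n R \<times> insert 0 (R \<inter> {1..n})) (descent_lists (Suc n) R)"
    (is "bij_betw ?f ?A ?B")
proof (rule bij_betw_imageI)
  show "inj_on ?f ?A"
  proof (rule inj_onI, clarify)
    fix xs b xs' b'
    assume xs: "xs \<in> descent_lists n R" "xs' \<in> descent_lists n R"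
      and b: "b \<in> insert 0 (R \<inter> {1..n})" "b' \<in> insert 0 (R \<inter> {1..n})"
      and eq: "takeWhile (\<lambda>a. a \<noteq> b) xs @ Suc n # dropWhile (\<lambda>a. a \<noteq> b) xs =
               takeWhile (\<lambda>a. a \<noteq> b') xs' @ Suc n # dropWhile (\<lambda>a. a \<noteq> b') xs'"
    have sets: "set xs = {1..n}" "set xs' = {1..n}"
      using xs by (auto simp: descent_lists_def)
    \<comment> \<open>\<open>Suc n\<close> occurs once in each word, so equal words have equal parts
      before it and after it.\<close>
    have "Suc n \<notin> set (takeWhile (\<lambda>a. a \<noteq> b) xs)" "Suc n \<notin> set (takeWhile (\<lambda>a. a \<noteq> b') xs')"
      "Suc n \<notin> set (dropWhile (\<lambda>a. a \<noteq> b) xs)" "Suc n \<notin> set (dropWhile (\<lambda>a. a \<noteq> b') xs')"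
      using sets by (auto dest!: set_takeWhileD set_dropWhileD)
    with eq have tw: "takeWhile (\<lambda>a. a \<noteq> b) xs = takeWhile (\<lambda>a. a \<noteq> b') xs'"
      and dw: "dropWhile (\<lambda>a. a \<noteq> b) xs = dropWhile (\<lambda>a. a \<noteq> b') xs'"
      by (auto simp: append_Cons_eq_iff)
    then have "xs = xs'"
      by (metis takeWhile_dropWhile_id)
    \<comment> \<open>Nonempty right parts start with \<open>b\<close> and \<open>b'\<close>; empty
      ones force both to be the absent letter 0.\<close>
    moreover have "b = b'"
    proof (cases "dropWhile (\<lambda>a. a \<noteq> b) xs = []")
      case True
      moreover from True have "dropWhile (\<lambda>a. a \<noteq> b') xs' = []"
        by (simp only: dw)
      ultimately have "b \<notin> set xs" "b' \<notin> set xs'"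
        unfolding dropWhile_eq_Nil_conv by blast+
      then show ?thesis using sets b by auto
    next
      case False
      then show ?thesis using hd_dropWhile[of "\<lambda>a. a \<noteq> b" xs] hd_dropWhile[of "\<lambda>a. a \<noteq> b'" xs'] dw
        by simp
    qed
    ultimately show "xs = xs' \<and> b = b'" ..
  qed
  show "?f ` ?A = ?B"
  proof (intro equalityI subsetI)
    fix ys assume "ys \<in> ?f ` ?A"
    then obtain z where z: "z \<in> ?A" "ys = ?f z"
      by blast
    obtain xs b where "z = (xs, b)"
      by (cases z)
    with z have xs: "xs \<in> descent_lists n R" and b: "b \<in> insert 0 (R \<inter> {1..n})"
      and ys: "ys = takeWhile (\<lambda>a. a \<noteq> b) xs @ Suc n # dropWhile (\<lambda>a. a \<noteq> b) xs"
      by auto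
    define us vs where "us = takeWhile (\<lambda>a. a \<noteq> b) xs" and "vs = dropWhile (\<lambda>a. a \<noteq> b) xs"
    have app: "xs = us @ vs" by (simp add: us_def vs_def)
    have hd: "vs \<noteq> [] \<Longrightarrow> hd vs = b"
      unfolding vs_def using hd_dropWhile[of "\<lambda>a. a \<noteq> b" xs] by simp
    have set: "distinct (us @ vs)" "set us \<union> set vs = {1..n}"
      "successively (\<lambda>a b. a < b \<or> b \<in> R) (us @ vs)"
      using xs unfolding app descent_lists_def by auto
    have "b \<in> R" if "vs \<noteq> []"
    proof -
      have "b \<in> {1..n}"
        using that hd hd_in_set[of vs] set(2) by blast
      then show ?thesis using b by auto
    qed
    moreover have "last us < Suc n" if "us \<noteq> []"
    proof -
      have "last us \<in> {1..n}"
        using that last_in_set[of us] set(2) by blast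
      then show ?thesis by auto
    qed
    moreover have "Suc n \<notin> set us \<union> set vs" unfolding set(2) by simp
    then have "Suc n \<notin> set us" "Suc n \<notin> set vs" by auto
    moreover have "insert (Suc n) (set us \<union> set vs) = {1..Suc n}" unfolding set(2) by auto
    ultimately show "ys \<in> ?B"
      using set hd unfolding ys us_def[symmetric] vs_def[symmetric] descent_lists_def
      by (auto simp: successively_append_iff successively_Cons)
  next
    fix ys assume ys: "ys \<in> ?B"
    then have ys': "distinct ys" "set ys = {1..Suc n}" "successively (\<lambda>a b. a < b \<or> b \<in> R) ys"
      unfolding descent_lists_def by blast+
    from ys'(2) have "Suc n \<in> set ys" by simp
    then obtain us vs where app: "ys = us @ Suc n # vs" by (meson split_list)
    define b where "b = (if vs = [] then 0 else hd vs)"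
    have dist: "distinct (us @ vs)" "Suc n \<notin> set us \<union> set vs"
      using ys'(1) by (simp_all add: app)
    have set: "insert (Suc n) (set us \<union> set vs) = {1..Suc n}"
      using ys'(2) unfolding app by (simp only: set_append list.set Un_insert_right)
    have succ: "successively (\<lambda>a b. a < b \<or> b \<in> R) (us @ Suc n # vs)"
      using ys'(3) unfolding app .
    have setn: "set us \<union> set vs = {1..n}"
    proof -
      have "set us \<union> set vs = insert (Suc n) (set us \<union> set vs) - {Suc n}"
        by (rule Diff_insert_absorb[OF dist(2), symmetric])
      also have "\<dots> = {1..n}"
        unfolding set by auto
      finally show ?thesis .
    qed
    have b: "vs \<noteq> [] \<Longrightarrow> hd vs \<in> R \<inter> {1..n}"
    proof -
      assume vs: "vs \<noteq> []"
      then have "hd vs \<in> {1..n}" using setn hd_in_set[of vs] by blast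
      moreover have "Suc n < hd vs \<or> hd vs \<in> R"
        using succ vs by (auto simp: successively_append_iff successively_Cons)
      ultimately show ?thesis by auto
    qed
    \<comment> \<open>Deleting \<open>Suc n\<close> makes \<open>last us\<close> and
      \<open>hd vs\<close> adjacent. This is permitted because \<open>hd vs\<close>, as the bottom
      of the descent from \<open>Suc n\<close>, lies in \<open>R\<close>.\<close>
    have "us @ vs \<in> descent_lists n R"
      using succ b dist setn by (auto simp: descent_lists_def successively_append_iff successively_Cons)
    moreover have "b \<notin> set us"
      using dist(1) setn by (auto simp: b_def)
    then have "takeWhile (\<lambda>a. a \<noteq> b) (us @ vs) = us \<and> dropWhile (\<lambda>a. a \<noteq> b) (us @ vs) = vs"
      by (cases vs) (auto simp: b_def takeWhile_append dropWhile_append intro!: gr0I)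
    ultimately show "ys \<in> ?f ` ?A"
      using b by (intro image_eqI[of _ _ "(us @ vs, b)"]) (auto simp: b_def app)
  qed
qed

lemma card_descent_lists: "card (descent_lists n R) = weight n R"
proof (induction n)
  case 0
  then show ?case by (simp add: descent_lists_0 weight_def)
next
  case (Suc n)
  have "card (descent_lists (Suc n) R) = card (descent_lists n R \<times> insert 0 (R \<inter> {1..n}))"
    by (rule bij_betw_same_card[OF descent_lists_Suc, symmetric])
  also have "\<dots> = weight n R * Suc (card (R \<inter> {1..n}))"
    by (simp add: card_cartesian_product Suc.IH card_insert_if)
  also have "\<dots> = weight (Suc n) R"
    by (simp add: weight_def atLeastLessThanSuc_atLeastAtMost)
  finally show ?case .
qed

lemma bij_betw_descent_perms:
  "bij_betw (\<lambda>\<pi>. map \<pi> [1..<Suc n]) (descent_perms n R) (descent_lists n R)"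
proof (rule bij_betw_imageI)
  have nth: "map \<pi> [1..<Suc n] ! k = \<pi> (Suc k)" if "k < n" for k and \<pi> :: "nat \<Rightarrow> nat"
    using that by (simp del: upt_Suc)
  have succ: "successively P (map \<pi> [1..<Suc n]) \<longleftrightarrow> (\<forall>k\<in>{1..<n}. P (\<pi> k) (\<pi> (k + 1)))"
    for P and \<pi> :: "nat \<Rightarrow> nat"
  proof -
    have "successively P (map \<pi> [1..<Suc n]) \<longleftrightarrow> (\<forall>k. Suc k < n \<longrightarrow> P (\<pi> (Suc k)) (\<pi> (Suc (Suc k))))"
      by (auto simp: successively_conv_nth nth simp del: upt_Suc)
    also have "\<dots> \<longleftrightarrow> (\<forall>k\<in>{1..<n}. P (\<pi> k) (\<pi> (k + 1)))"
      by (auto simp: Suc_le_eq gr0_conv_Suc)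
    finally show ?thesis .
  qed
  show "inj_on (\<lambda>\<pi>. map \<pi> [1..<Suc n]) (descent_perms n R)"
  proof (rule inj_onI)
    fix \<pi> \<sigma> assume *: "\<pi> \<in> descent_perms n R" "\<sigma> \<in> descent_perms n R"
      "map \<pi> [1..<Suc n] = map \<sigma> [1..<Suc n]"
    then have "\<forall>k\<in>{1..n}. \<pi> k = \<sigma> k"
      by (auto simp del: upt_Suc)
    moreover have "\<forall>k. k \<notin> {1..n} \<longrightarrow> \<pi> k = \<sigma> k"
      using * by (auto simp: descent_perms_def descent_bottoms_in_def permutes_def)
    ultimately show "\<pi> = \<sigma>" by (intro ext) blast
  qed
  show "(\<lambda>\<pi>. map \<pi> [1..<Suc n]) ` descent_perms n R = descent_lists n R"
  proof (intro equalityI subsetI)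
    fix xs assume "xs \<in> (\<lambda>\<pi>. map \<pi> [1..<Suc n]) ` descent_perms n R"
    then obtain \<pi> where \<pi>: "\<pi> \<in> descent_perms n R" and xs: "xs = map \<pi> [1..<Suc n]" by blast
    have perm: "\<pi> permutes {1..n}" using \<pi> by (simp add: descent_perms_def descent_bottoms_in_def)
    have "set xs = \<pi> ` {1..n}" by (simp add: xs atLeastLessThanSuc_atLeastAtMost del: upt_Suc)
    then have "set xs = {1..n}" using permutes_image[OF perm] by simp
    moreover have "distinct xs"
      using permutes_inj_on[OF perm] by (simp add: xs distinct_map del: upt_Suc)
    moreover have "successively (\<lambda>a b. a < b \<or> b \<in> R) xs"
      unfolding xs succ
    proof
      fix k assume k: "k \<in> {1..<n}"
      have "\<pi> k \<noteq> \<pi> (k + 1)" using permutes_inj[OF perm] by (simp add: inj_eq)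
      moreover have "\<pi> (k + 1) < \<pi> k \<longrightarrow> \<pi> (k + 1) \<in> R"
        using \<pi> k unfolding descent_perms_def descent_bottoms_in_def by blast
      ultimately show "\<pi> k < \<pi> (k + 1) \<or> \<pi> (k + 1) \<in> R"
        by linarith
    qed
    ultimately show "xs \<in> descent_lists n R" by (simp add: descent_lists_def)
  next
    fix xs assume xs: "xs \<in> descent_lists n R"
    then have set: "distinct xs" "set xs = {1..n}" by (auto simp: descent_lists_def)
    then have len: "length xs = n" using distinct_card by fastforce
    define \<pi> where "\<pi> k = (if k \<in> {1..n} then xs ! (k - 1) else k)" for k
    have map: "map \<pi> [1..<Suc n] = xs"
      by (rule nth_equalityI) (auto simp: len nth \<pi>_def simp del: upt_Suc)
    have "bij_betw \<pi> {1..n} {1..n}"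
    proof (rule bij_betw_imageI)
      show "inj_on \<pi> {1..n}"
        using set len by (auto simp: inj_on_def \<pi>_def nth_eq_iff_index_eq)
      have "set (map \<pi> [1..<Suc n]) = \<pi> ` {1..n}"
        by (simp add: atLeastLessThanSuc_atLeastAtMost del: upt_Suc)
      then show "\<pi> ` {1..n} = {1..n}" unfolding map set(2) by simp
    qed
    then have "\<pi> permutes {1..n}"
      by (rule bij_imp_permutes) (auto simp: \<pi>_def)
    moreover have "\<forall>k\<in>{1..<n}. \<pi> k < \<pi> (k + 1) \<or> \<pi> (k + 1) \<in> R"
      using xs succ[of "\<lambda>a b. a < b \<or> b \<in> R" \<pi>] unfolding map by (simp add: descent_lists_def)
    ultimately have "\<pi> \<in> descent_perms n R"
      unfolding descent_perms_def descent_bottoms_in_def by (auto dest: bspec)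
    then show "xs \<in> (\<lambda>\<pi>. map \<pi> [1..<Suc n]) ` descent_perms n R"
      using map by blast
  qed
qed

lemma card_descent_perms: "card (descent_perms n R) = weight n R"
  using bij_betw_same_card[OF bij_betw_descent_perms] card_descent_lists by metis

subsection \<open>Removing the largest vertex from a parent function\<close>

definition parent_functions :: "nat \<Rightarrow> (nat \<Rightarrow> enat) set" where
  "parent_functions n = {p. parent_function n p}"

definition roots :: "nat \<Rightarrow> (nat \<Rightarrow> enat) \<Rightarrow> nat set" where
  "roots n p = {u\<in>{1..n}. p u = \<infinity>}"

definition parents :: "nat \<Rightarrow> (nat \<Rightarrow> enat) \<Rightarrow> nat set" where
  "parents n p = {v. enat v \<in> p ` {1..n}}"

lemma parent_functions_iff:
  "p \<in> parent_functions n \<longleftrightarrow>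
     (\<forall>u. u \<notin> {1..n} \<longrightarrow> p u = undefined) \<and>
     (\<forall>u\<in>{1..n}. p u = \<infinity> \<or> (\<exists>v. p u = enat v \<and> u < v \<and> v \<le> n))"
proof -
  have "(p u \<in> enat ` {2..n} \<union> {\<infinity>} \<and> enat u < p u) \<longleftrightarrow>
      p u = \<infinity> \<or> (\<exists>v. p u = enat v \<and> u < v \<and> v \<le> n)" if "u \<in> {1..n}" for u
    using that by (cases "p u") auto
  then have "(\<forall>u\<in>{1..n}. p u \<in> enat ` {2..n} \<union> {\<infinity>} \<and> enat u < p u) \<longleftrightarrow>
      (\<forall>u\<in>{1..n}. p u = \<infinity> \<or> (\<exists>v. p u = enat v \<and> u < v \<and> v \<le> n))"
    by (rule ball_cong[OF refl])
  then show ?thesis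
    unfolding parent_functions_def parent_function_def PiE_iff extensional_def mem_Collect_eq
    by blast
qed

lemma finite_parent_functions [simp]: "finite (parent_functions n)"
proof (rule finite_subset)
  show "parent_functions n \<subseteq> {1..n} \<rightarrow>\<^sub>E enat ` {2..n} \<union> {\<infinity>}"
    by (auto simp: parent_functions_def parent_function_def)
qed (intro finite_PiE, auto)

lemma finite_roots [simp]: "finite (roots n p)"
  by (simp add: roots_def)

lemma parent_functions_enat:
  assumes "p \<in> parent_functions n" "u \<in> {1..n}" "p u = enat v"
  shows "u < v" and "v \<le> n"
proof -
  have "p u = \<infinity> \<or> (\<exists>v. p u = enat v \<and> u < v \<and> v \<le> n)"
    using assms(1,2) unfolding parent_functions_iff by blast
  then show "u < v" "v \<le> n"
    using assms(3) by auto
qed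

lemma parent_functions_last:
  assumes "p \<in> parent_functions n" "n > 0"
  shows "p n = \<infinity>"
proof (rule ccontr)
  assume "p n \<noteq> \<infinity>"
  then obtain v where "p n = enat v" by auto
  then show False
    using parent_functions_enat[OF assms(1), of n v] assms(2) by simp
qed

lemma parents_subset:
  assumes "p \<in> parent_functions n"
  shows "parents n p \<subseteq> {2..n}"
proof
  fix v assume "v \<in> parents n p"
  then obtain u where "u \<in> {1..n}" "p u = enat v"
    unfolding parents_def by fastforce
  then show "v \<in> {2..n}"
    using parent_functions_enat[OF assms, of u v] by simp
qed

text \<open>The vertex \<open>n\<close> has no vertex above it, so \<infinity> is always a value of
  \<open>p\<close>. It accounts for the \<open>j + 1\<close> in the definition of the type, where
  \<open>j\<close> is the number of parents.\<close>

lemma card_range: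
  assumes "p \<in> parent_functions n" "n > 0"
  shows "card (p ` {1..n}) = Suc (card (parents n p))"
proof -
  have "p n \<in> p ` {1..n}"
    using assms(2) by (intro imageI) simp
  then have 1: "\<infinity> \<in> p ` {1..n}"
    unfolding parent_functions_last[OF assms] .
  have 2: "e = \<infinity> \<or> e \<in> enat ` parents n p" if "e \<in> p ` {1..n}" for e
    using that by (cases e) (simp_all add: parents_def)
  have 3: "enat ` parents n p \<subseteq> p ` {1..n}"
    by (auto simp: parents_def)
  have "p ` {1..n} = insert \<infinity> (enat ` parents n p)"
  proof (intro equalityI subsetI)
    fix e assume "e \<in> p ` {1..n}"
    then show "e \<in> insert \<infinity> (enat ` parents n p)"
      unfolding insert_iff by (rule 2)
  next
    fix e assume "e \<in> insert \<infinity> (enat ` parents n p)"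
    then show "e \<in> p ` {1..n}"
      using 1 subsetD[OF 3] by (elim insertE) simp_all
  qed
  moreover have "finite (parents n p)"
    using parents_subset[OF assms(1)] finite_subset by blast
  moreover have "\<infinity> \<notin> enat ` parents n p"
    by auto
  ultimately show ?thesis
    by (simp add: card_image inj_on_def)
qed

section \<open>Attaching and deleting the largest vertex\<close>

text \<open>\<open>U\<close> consists of the former roots that become children of the new vertex
  \<open>Suc n\<close>, which is itself a root.\<close>

definition extend :: "nat \<Rightarrow> (nat \<Rightarrow> enat) \<Rightarrow> nat set \<Rightarrow> nat \<Rightarrow> enat" where
  "extend n p U u = (if u \<in> U then enat (Suc n) else if u = Suc n then \<infinity> else p u)"

lemma extend_parent_functions:
  assumes p: "p \<in> parent_functions n" and U: "U \<subseteq> roots n p"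
  shows "extend n p U \<in> parent_functions (Suc n)"
  unfolding parent_functions_iff
proof (intro conjI allI ballI impI)
  fix u assume u: "u \<notin> {1..Suc n}"
  then have "u \<notin> {1..n}" "u \<notin> U" "u \<noteq> Suc n"
    using U by (auto simp: roots_def)
  then show "extend n p U u = undefined"
    using p unfolding parent_functions_iff by (simp add: extend_def)
next
  fix u assume u: "u \<in> {1..Suc n}"
  consider "u \<in> U" | "u \<notin> U" "u = Suc n" | "u \<notin> U" "u \<noteq> Suc n" "u \<in> {1..n}"
    using u by fastforce
  then show "extend n p U u = \<infinity> \<or> (\<exists>v. extend n p U u = enat v \<and> u < v \<and> v \<le> Suc n)"
  proof cases
    case 1
    then have "u \<le> n" using U by (auto simp: roots_def)
    then show ?thesis using 1 by (simp add: extend_def)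
  next
    case 2
    then show ?thesis by (simp add: extend_def)
  next
    case 3
    then show ?thesis
    proof (cases "p u")
      case (enat v)
      then show ?thesis
        using 3 parent_functions_enat[OF p 3(3) enat] by (simp add: extend_def)
    qed (simp add: extend_def)
  qed
qed

text \<open>The children of the deleted vertex become roots again.\<close>

definition truncate :: "nat \<Rightarrow> (nat \<Rightarrow> enat) \<Rightarrow> nat \<Rightarrow> enat" where
  "truncate n q u =
     (if u \<in> {1..n} then if q u = enat (Suc n) then \<infinity> else q u else undefined)"

lemma truncate_parent_functions:
  assumes q: "q \<in> parent_functions (Suc n)"
  shows "truncate n q \<in> parent_functions n"
  unfolding parent_functions_iff
proof (intro conjI allI ballI impI)
  fix u assume u: "u \<in> {1..n}"
  then have u': "u \<in> {1..Suc n}" by simp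
  show "truncate n q u = \<infinity> \<or> (\<exists>v. truncate n q u = enat v \<and> u < v \<and> v \<le> n)"
  proof (cases "q u")
    case (enat v)
    then show ?thesis
      using u parent_functions_enat[OF q u' enat] by (cases "v = Suc n") (simp_all add: truncate_def)
  next
    case infinity
    then show ?thesis using u by (simp add: truncate_def)
  qed
qed (simp only: truncate_def if_False)

lemma extend_truncate:
  assumes q: "q \<in> parent_functions (Suc n)"
  shows "extend n (truncate n q) {u\<in>{1..n}. q u = enat (Suc n)} = q"
proof
  fix u
  consider "u = Suc n" | "u \<in> {1..n}" | "u \<noteq> Suc n" "u \<notin> {1..n}" "u \<notin> {1..Suc n}"
    by fastforce
  then show "extend n (truncate n q) {u\<in>{1..n}. q u = enat (Suc n)} u = q u"
  proof cases
    case 1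
    then show ?thesis using parent_functions_last[OF q] by (simp add: extend_def)
  next
    case 2
    then show ?thesis by (simp add: extend_def truncate_def)
  next
    case 3
    then have "q u = undefined" using q unfolding parent_functions_iff by blast
    with 3 show ?thesis by (simp add: extend_def truncate_def)
  qed
qed

lemma
  assumes p: "p \<in> parent_functions n" and U: "U \<subseteq> roots n p"
  shows truncate_extend: "truncate n (extend n p U) = p"
    and extend_eq_Suc: "{u\<in>{1..n}. extend n p U u = enat (Suc n)} = U"
proof -
  have ne: "p u \<noteq> enat (Suc n)" if "u \<in> {1..n}" for u
    using parent_functions_enat(2)[OF p that, of "Suc n"] by auto
  have U': "u \<in> {1..n}" "p u = \<infinity>" if "u \<in> U" for u
    using that U by (auto simp: roots_def)
  show "truncate n (extend n p U) = p"
  proof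
    fix u
    show "truncate n (extend n p U) u = p u"
    proof (cases "u \<in> {1..n}")
      case True
      then show ?thesis
        using ne[OF True] U'(2)[of u] by (simp add: truncate_def extend_def)
    next
      case False
      then have "p u = undefined" using p unfolding parent_functions_iff by blast
      then show ?thesis by (simp only: truncate_def False if_False)
    qed
  qed
  show "{u\<in>{1..n}. extend n p U u = enat (Suc n)} = U"
  proof (intro equalityI subsetI)
    fix u assume "u \<in> {u\<in>{1..n}. extend n p U u = enat (Suc n)}"
    then show "u \<in> U"
      using ne[of u] by (simp add: extend_def split: if_splits)
  next
    fix u assume "u \<in> U"
    then show "u \<in> {u\<in>{1..n}. extend n p U u = enat (Suc n)}"
      using U'(1)[of u] by (simp add: extend_def)
  qed
qed

text \<open>A parent function on \<open>Suc n\<close> vertices amounts to one on \<open>n\<close>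
  vertices together with the set of its roots that are attached to the new vertex.\<close>

lemma sum_parent_functions_Suc:
  "sum f (parent_functions (Suc n)) =
     (\<Sum>p\<in>parent_functions n. \<Sum>U\<in>Pow (roots n p). f (extend n p U))"
proof -
  have "sum f (parent_functions (Suc n)) =
      (\<Sum>(p, U)\<in>(SIGMA p:parent_functions n. Pow (roots n p)). f (extend n p U))"
  proof (rule sum.reindex_bij_witness[where i = "\<lambda>(p, U). extend n p U"
        and j = "\<lambda>q. (truncate n q, {u\<in>{1..n}. q u = enat (Suc n)})"])
    fix q assume q: "q \<in> parent_functions (Suc n)"
    have "{u\<in>{1..n}. q u = enat (Suc n)} \<subseteq> roots n (truncate n q)"
      by (auto simp: roots_def truncate_def)
    then show "(truncate n q, {u\<in>{1..n}. q u = enat (Suc n)})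
        \<in> (SIGMA p:parent_functions n. Pow (roots n p))"
      using truncate_parent_functions[OF q] by simp
  next
    fix pU assume "pU \<in> (SIGMA p:parent_functions n. Pow (roots n p))"
    then show "(truncate n (case pU of (p, U) \<Rightarrow> extend n p U),
        {u\<in>{1..n}. (case pU of (p, U) \<Rightarrow> extend n p U) u = enat (Suc n)}) = pU"
      by (elim SigmaE) (simp only: prod.case truncate_extend extend_eq_Suc Pow_iff)
  qed (auto simp only: prod.case extend_truncate Pow_iff intro!: extend_parent_functions)
  then show ?thesis
    by (simp add: sum.Sigma)
qed

lemma roots_extend:
  assumes "U \<subseteq> roots n p"
  shows "card (roots (Suc n) (extend n p U)) = Suc (card (roots n p) - card U)"
proof -
  have "roots (Suc n) (extend n p U) = insert (Suc n) (roots n p - U)"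
    using assms by (auto simp: roots_def extend_def le_Suc_eq)
  moreover have "Suc n \<notin> roots n p - U" by (auto simp: roots_def)
  moreover have "finite U" using assms finite_subset finite_roots by blast
  ultimately show ?thesis
    using assms by (simp add: card_Diff_subset)
qed

lemma parents_extend:
  assumes U: "U \<subseteq> roots n p"
  shows "parents (Suc n) (extend n p U) = parents n p \<union> (if U = {} then {} else {Suc n})"
proof -
  have U': "u \<in> {1..Suc n}" "extend n p U u = enat (Suc n)" if "u \<in> U" for u
    using that U by (auto simp: roots_def extend_def)
  have noU: "extend n p U u = (if u = Suc n then \<infinity> else p u)" if "u \<notin> U" for u
    using that by (simp add: extend_def)
  show ?thesis
  proof (intro equalityI subsetI)
    fix v assume "v \<in> parents (Suc n) (extend n p U)"
    then obtain u where u: "u \<in> {1..Suc n}" "extend n p U u = enat v"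
      unfolding parents_def by fastforce
    show "v \<in> parents n p \<union> (if U = {} then {} else {Suc n})"
    proof (cases "u \<in> U")
      case True
      then show ?thesis using u(2) U'(2)[OF True] by auto
    next
      case False
      then have "u \<noteq> Suc n" "p u = enat v"
        using u(2) noU[OF False] by (simp_all split: if_splits)
      then have "v \<in> parents n p"
        using u(1) unfolding parents_def by (metis (mono_tags, lifting) atLeastAtMost_iff image_eqI le_Suc_eq mem_Collect_eq)
      then show ?thesis by simp
    qed
  next
    fix v assume v: "v \<in> parents n p \<union> (if U = {} then {} else {Suc n})"
    have "\<exists>u\<in>{1..Suc n}. extend n p U u = enat v"
    proof (cases "v \<in> parents n p")
      case True
      then obtain u where u: "u \<in> {1..n}" "p u = enat v"
        unfolding parents_def by fastforce
      then have "u \<notin> U" "u \<noteq> Suc n" "u \<in> {1..Suc n}"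
        using U by (auto simp: roots_def)
      moreover from this have "extend n p U u = enat v"
        using u(2) noU[of u] by simp
      ultimately show ?thesis by blast
    next
      case False
      then obtain u where "u \<in> U" "v = Suc n"
        using v by (auto split: if_splits)
      then show ?thesis using U' by blast
    qed
    then show "v \<in> parents (Suc n) (extend n p U)"
      unfolding parents_def by (metis (mono_tags, lifting) image_eqI mem_Collect_eq)
  qed
qed

text \<open>Each factor of \<open>weight\<close> looks only at parents below its letter. The
  possible new parent \<open>Suc n\<close> is seen by none of them, and the new factor sees all old
  parents, so the result does not depend on \<open>U\<close>.\<close>

lemma weight_extend:
  assumes "p \<in> parent_functions n" "U \<subseteq> roots n p"
  shows "weight (Suc n) (parents (Suc n) (extend n p U)) =
     weight n (parents n p) * Suc (card (parents n p))"
proof -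
  have "parents (Suc n) (extend n p U) \<inter> {1..<v} = parents n p \<inter> {1..<v}" if "v \<le> Suc n" for v
    using that by (auto simp: parents_extend[OF assms(2)] split: if_splits)
  moreover have "parents n p \<inter> {1..<Suc n} = parents n p"
    using parents_subset[OF assms(1)] by auto
  ultimately show ?thesis
    by (simp add: weight_def prod.cl_ivl_Suc)
qed

section \<open>Recurrence for the weighted count of parent functions\<close>

text \<open>Expand the product of \<open>1 + x\<close> over \<open>A\<close>, with \<open>U\<close>
  the set of factors that contribute 1. This sum is the source of the shift from \<open>x\<close> to
  \<open>x + 1\<close>.\<close>

lemma sum_Pow_power:
  fixes x :: "'a::comm_ring_1"
  assumes "finite A"
  shows "(\<Sum>U\<in>Pow A. x ^ (card A - card U)) = (x + 1) ^ card A"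
proof -
  have "(x + 1) ^ card A = (\<Prod>a\<in>A. 1 + x)" by (simp add: add.commute)
  also have "\<dots> = (\<Sum>U\<in>Pow A. (\<Prod>a\<in>U. 1) * (\<Prod>a\<in>A - U. x))"
    by (rule prod_add[OF assms])
  also have "\<dots> = (\<Sum>U\<in>Pow A. x ^ (card A - card U))"
    using assms by (intro sum.cong) (auto simp: card_Diff_subset finite_subset)
  finally show ?thesis ..
qed

text \<open>The polynomial \<open>B n j\<close> of the outline, over any commutative ring so that a
  power series can be substituted for \<open>x\<close>. At \<open>j = 0\<close> the factor
  \<open>of_nat j\<close> removes the terms with the truncated index \<open>j - 1\<close>.\<close>

primrec type_poly :: "nat \<Rightarrow> nat \<Rightarrow> 'a::comm_ring_1 \<Rightarrow> 'a" where
  "type_poly 0 j x = of_bool (j = 0)"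
| "type_poly (Suc n) j x =
     x * (of_nat (Suc j) * type_poly n j x +
          of_nat j * (type_poly n (j - 1) (x + 1) - type_poly n (j - 1) x))"

text \<open>Counts pairs of a parent function and a permutation whose descent bottoms are parents;
  the permutations are summed out into \<open>weight\<close>, and \<open>x\<close> marks the
  roots.\<close>

definition code_poly :: "nat \<Rightarrow> nat \<Rightarrow> 'a::comm_ring_1 \<Rightarrow> 'a" where
  "code_poly n j x = (\<Sum>p | p \<in> parent_functions n \<and> card (parents n p) = j.
     of_nat (weight n (parents n p)) * x ^ card (roots n p))"

lemma code_poly_altdef:
  "code_poly n j x = (\<Sum>p\<in>parent_functions n. of_bool (card (parents n p) = j) *
     (of_nat (weight n (parents n p)) * x ^ card (roots n p)))"
  unfolding code_poly_def by (rule sum.mono_neutral_cong_left) auto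

text \<open>Attaching no root to the new vertex keeps the number of parents, attaching some raises
  it by one. The weight gains one plus the old number of parents, which is \<open>j + 1\<close> in
  the first case and \<open>j\<close> in the second.\<close>

lemma code_poly_eq: "code_poly n j x = type_poly n j x"
proof (induction n arbitrary: j x)
  case 0
  have "parent_functions 0 = {\<lambda>_. undefined}"
    by (auto simp: parent_functions_iff)
  then show ?case
    by (auto simp: code_poly_altdef weight_def roots_def parents_def)
next
  case (Suc n)
  let ?P = "\<lambda>p. of_nat (weight n (parents n p)) :: 'a"
  let ?c = "\<lambda>p. card (parents n p)" and ?r = "\<lambda>p. card (roots n p)"
  let ?h = "\<lambda>q. of_bool (card (parents (Suc n) q) = j) *
     (of_nat (weight (Suc n) (parents (Suc n) q)) * x ^ card (roots (Suc n) q))"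
  have step: "(\<Sum>U\<in>Pow (roots n p). ?h (extend n p U)) =
      x * (of_nat (Suc j) * (of_bool (?c p = j) * (?P p * x ^ ?r p)) +
           of_nat j * (of_bool (?c p = j - 1) * (?P p * (x + 1) ^ ?r p) -
                       of_bool (?c p = j - 1) * (?P p * x ^ ?r p)))"
    if p: "p \<in> parent_functions n" for p
  proof -
    have fin: "finite (parents n p)" and notin: "Suc n \<notin> parents n p"
      using parents_subset[OF p] finite_subset by auto
    have card: "card (parents (Suc n) (extend n p U)) = ?c p + of_bool (U \<noteq> {})"
      if "U \<subseteq> roots n p" for U
      using fin notin by (simp add: parents_extend[OF that])
    have h: "?h (extend n p U) = of_bool (?c p + of_bool (U \<noteq> {}) = j) *
        (?P p * of_nat (Suc (?c p)) * x) * x ^ (?r p - card U)" if "U \<subseteq> roots n p" for U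
      unfolding card[OF that] weight_extend[OF p that] roots_extend[OF that]
      by (simp only: of_nat_mult power_Suc mult_ac)
    have "(\<Sum>U\<in>Pow (roots n p). ?h (extend n p U)) = ?h (extend n p {}) +
        (\<Sum>U\<in>Pow (roots n p) - {{}}. ?h (extend n p U))"
      by (rule sum.remove) simp_all
    also have "(\<Sum>U\<in>Pow (roots n p) - {{}}. ?h (extend n p U)) =
        (\<Sum>U\<in>Pow (roots n p) - {{}}. of_bool (?c p + 1 = j) *
          (?P p * of_nat (Suc (?c p)) * x) * x ^ (?r p - card U))"
    proof (rule sum.cong[OF refl])
      fix U assume "U \<in> Pow (roots n p) - {{}}"
      then have U: "U \<subseteq> roots n p" "U \<noteq> {}" by simp_all
      show "?h (extend n p U) = of_bool (?c p + 1 = j) *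
          (?P p * of_nat (Suc (?c p)) * x) * x ^ (?r p - card U)"
        unfolding h[OF U(1)] using U(2) by simp
    qed
    also have "\<dots> = of_bool (?c p + 1 = j) * (?P p * of_nat (Suc (?c p)) * x) *
          (\<Sum>U\<in>Pow (roots n p) - {{}}. x ^ (?r p - card U))"
      by (simp only: sum_distrib_left)
    \<comment> \<open>The full subset sum without the term of the empty set.\<close>
    also have "(\<Sum>U\<in>Pow (roots n p) - {{}}. x ^ (?r p - card U)) = (x + 1) ^ ?r p - x ^ ?r p"
      by (simp add: sum_diff1 sum_Pow_power)
    also have "?h (extend n p {}) =
        of_bool (?c p = j) * (?P p * of_nat (Suc (?c p)) * x) * x ^ ?r p"
      unfolding h[OF empty_subsetI] by simp
    also have "\<dots> = x * (of_nat (Suc j) * (of_bool (?c p = j) * (?P p * x ^ ?r p)))"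
      by (cases "?c p = j") (simp_all only: of_bool_eq mult_ac mult_1_left mult_zero_left mult_zero_right)
    also have "of_bool (?c p + 1 = j) * (?P p * of_nat (Suc (?c p)) * x) *
          ((x + 1) ^ ?r p - x ^ ?r p) =
        x * (of_nat j * (of_bool (?c p = j - 1) * (?P p * (x + 1) ^ ?r p) -
                       of_bool (?c p = j - 1) * (?P p * x ^ ?r p)))"
      \<comment> \<open>For \<open>j = 0\<close> both sides vanish; otherwise the condition says
        that the old number of parents is \<open>j - 1\<close>.\<close>
      by (cases j) (auto simp: of_bool_def algebra_simps)
    finally show ?thesis
      by (simp only: distrib_left)
  qed
  have "code_poly (Suc n) j x = (\<Sum>p\<in>parent_functions n.
      x * (of_nat (Suc j) * (of_bool (?c p = j) * (?P p * x ^ ?r p)) +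
           of_nat j * (of_bool (?c p = j - 1) * (?P p * (x + 1) ^ ?r p) -
                       of_bool (?c p = j - 1) * (?P p * x ^ ?r p))))"
    unfolding code_poly_altdef sum_parent_functions_Suc by (rule sum.cong[OF refl step])
  also have "\<dots> = x * (of_nat (Suc j) * code_poly n j x +
      of_nat j * (code_poly n (j - 1) (x + 1) - code_poly n (j - 1) x))"
    unfolding code_poly_altdef
    by (simp only: sum_distrib_left[symmetric] sum.distrib sum_subtractf)
  finally show ?case
    by (simp only: Suc.IH type_poly.simps)
qed

subsection \<open>The generating functions\<close>

text \<open>The coefficients may themselves be power series, hence no field. The hypothesis has the
  shape of the conclusion, so the rule descends through iterated series down to the rational
  constant term.\<close>

lemma fps_mult_inverse_eq_1:
  fixes g :: "'a::{comm_ring_1,inverse} fps"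
  assumes "g $ 0 * inverse (g $ 0) = 1"
  shows "g * inverse g = 1"
  unfolding fps_inverse_def using assms by (rule fps_right_inverse)

lemma fps_xty_mult_inverse:
  fixes g :: fps_xty
  assumes "g $ 0 $ 0 $ 0 \<noteq> 0"
  shows "g * inverse g = 1"
  using assms by (intro fps_mult_inverse_eq_1) simp

lemma fps_xty_divide:
  fixes f g :: fps_xty
  assumes "g $ 0 $ 0 $ 0 \<noteq> 0"
  shows "f / g = f * inverse g" and "f / g * g = f"
proof -
  have "g $ 0 \<noteq> 0"
    using assms by auto
  then show *: "f / g = f * inverse g"
    by (rule fps_divide_unit)
  have "f / g * g = f * (g * inverse g)"
    unfolding * by (simp only: mult_ac)
  then show "f / g * g = f"
    by (simp add: fps_xty_mult_inverse[OF assms])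
qed

text \<open>
  Substituting \<open>x + 1\<close> for \<open>x\<close> is not an operation on power series in \<open>x\<close>, so the shifted series are
  indexed by the total shift \<open>m\<close>.
\<close>

definition denom :: "nat \<Rightarrow> nat \<Rightarrow> fps_xty" where
  "denom m c = 1 - (var_x + of_nat m) * of_nat c * var_t"

definition factor :: "nat \<Rightarrow> nat \<Rightarrow> fps_xty" where
  "factor m c = (var_x + of_nat m) * of_nat c * var_t / denom m c"

text \<open>\<open>G k\<close> of the outline at \<open>x + m\<close>, with the factor
  \<open>1 / (k + 1)\<close> included.\<close>

definition altsum :: "nat \<Rightarrow> nat \<Rightarrow> fps_xty" where
  "altsum m k = 1 / of_nat (k + 1) *
     (\<Sum>i=0..k. (-1) ^ (k - i) * (\<Prod>l=0..i. factor (m + l) (k + 1 - l)))"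

text \<open>The constant term in \<open>t\<close> is removed because \<open>alpha\<close> starts at
  \<open>n = 1\<close>, whereas \<open>type_poly 0 0\<close> is 1.\<close>

definition type_gf :: "nat \<Rightarrow> nat \<Rightarrow> fps_xty" where
  "type_gf m j = fps_const (Abs_fps (\<lambda>n.
     if n = 0 then 0 else type_poly n j (fps_X + of_nat m)))"

lemma denom_nth_0 [simp]: "denom m c $ 0 $ 0 $ 0 = 1"
  by (simp add: denom_def var_t_def)

lemma denom_neq_0 [simp]: "denom m c \<noteq> 0"
  by (metis denom_nth_0 fps_zero_nth zero_neq_one)

lemma factor_denom: "factor m c * denom m c = (var_x + of_nat m) * of_nat c * var_t"
  unfolding factor_def by (rule fps_xty_divide) simp

lemma fps_xty_of_nat_nth_0 [simp]: "(of_nat c :: fps_xty) $ 0 $ 0 $ 0 = of_nat c"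
  by (simp add: fps_of_nat[symmetric])

lemma inverse_of_nat_mult: "1 / of_nat (k + 1) * (of_nat (k + 1) :: fps_xty) = 1"
  by (rule fps_xty_divide) (simp add: fps_xty_of_nat_nth_0 del: of_nat_Suc of_nat_add)

section \<open>The recurrences of both sides and their comparison\<close>

text \<open>All products share the factor with \<open>l = 0\<close>. What is left are the products
  for \<open>k - 1\<close> and shift \<open>Suc m\<close>, while the term \<open>i = 0\<close>
  leaves \<open>(-1) ^ k\<close>.\<close>

lemma altsum_eq:
  "altsum m k * denom m (k + 1) =
     (var_x + of_nat m) * var_t * (of_nat k * altsum (Suc m) (k - 1) + (-1) ^ k)"
proof -
  let ?w = "1 / of_nat (k + 1) :: fps_xty"
  let ?D = "\<lambda>m k i. \<Prod>l=0..i. factor (m + l) (k + 1 - l)"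
  have *: "(\<Sum>i=0..k. (-1) ^ (k - i) * ?D m k i) =
      factor m (k + 1) * (of_nat k * altsum (Suc m) (k - 1) + (-1) ^ k)"
  proof (cases k)
    case 0
    then show ?thesis by simp
  next
    case (Suc k')
    \<comment> \<open>Raising \<open>l\<close> by one raises the shift, and
      \<open>k + 1 - Suc l\<close> equals \<open>k' + 1 - l\<close>.\<close>
    have "?D m k (Suc i) = factor m (k + 1) * ?D (Suc m) k' i" for i
      by (simp add: prod.atLeast0_atMost_Suc_shift Suc del: prod.cl_ivl_Suc)
    then have "(\<Sum>i=0..k. (-1) ^ (k - i) * ?D m k i) = (-1) ^ k * factor m (k + 1) +
        factor m (k + 1) * (\<Sum>i=0..k'. (-1) ^ (k' - i) * ?D (Suc m) k' i)"
      by (simp add: sum.atLeast0_atMost_Suc_shift Suc sum_distrib_left mult_ac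
          del: sum.cl_ivl_Suc prod.cl_ivl_Suc)
    \<comment> \<open>Since \<open>k = Suc k'\<close>, the factor \<open>of_nat k\<close> cancels
      the reciprocal inside \<open>altsum (Suc m) (k - 1)\<close>.\<close>
    moreover have "(\<Sum>i=0..k'. (-1) ^ (k' - i) * ?D (Suc m) k' i) =
        of_nat k * altsum (Suc m) (k - 1)"
      using arg_cong[OF inverse_of_nat_mult[of k'],
          of "\<lambda>z. z * (\<Sum>i=0..k'. (-1) ^ (k' - i) * ?D (Suc m) k' i)"]
      by (simp only: altsum_def Suc) (simp add: mult_ac)
    ultimately show ?thesis
      by (simp add: algebra_simps)
  qed
  have "altsum m k * denom m (k + 1) =
      ?w * (factor m (k + 1) * denom m (k + 1)) * (of_nat k * altsum (Suc m) (k - 1) + (-1) ^ k)"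
    unfolding altsum_def[of m k] * by (simp only: mult_ac)
  also have "\<dots> = (?w * of_nat (k + 1)) *
      ((var_x + of_nat m) * var_t * (of_nat k * altsum (Suc m) (k - 1) + (-1) ^ k))"
    unfolding factor_denom by (simp only: mult_ac)
  finally show ?thesis
    unfolding inverse_of_nat_mult by simp
qed

text \<open>Series form of the recurrence of \<open>type_poly\<close>; multiplying by
  \<open>denom\<close> collects the terms with index \<open>j\<close> on the left. The summand
  \<open>of_bool (j = 0)\<close> is the initial value \<open>type_poly 0 j\<close>, which is removed
  from the series but enters its coefficient at \<open>n = 1\<close>.\<close>

lemma type_gf_eq:
  "type_gf m j * denom m (j + 1) = (var_x + of_nat m) * var_t *
     (of_nat j * (type_gf (Suc m) (j - 1) - type_gf m (j - 1)) + of_bool (j = 0))"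
proof -
  define P :: "nat \<Rightarrow> nat \<Rightarrow> rat fps fps" where
    "P m j = Abs_fps (\<lambda>n. if n = 0 then 0 else type_poly n j (fps_X + of_nat m))" for m j
  define x :: "rat fps" where "x = fps_X + of_nat m"
  have shift: "(P (Suc m) i) $ n = (if n = 0 then 0 else type_poly n i (x + 1))" for i n
    by (simp add: P_def x_def add_ac)
  have noshift: "(P m i) $ n = (if n = 0 then 0 else type_poly n i x)" for i n
    by (simp add: P_def x_def)
  \<comment> \<open>The identity is compared coefficientwise in \<open>t\<close> before it is
    embedded as a constant in \<open>y\<close>.\<close>
  have "P m j - fps_X * fps_const (x * of_nat (j + 1)) * P m j = fps_X * (fps_const x *
     (fps_const (of_nat j) * (P (Suc m) (j - 1) - P m (j - 1)) + of_bool (j = 0)))"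
  proof (rule fps_ext)
    fix n
    show "(P m j - fps_X * fps_const (x * of_nat (j + 1)) * P m j) $ n = (fps_X * (fps_const x *
      (fps_const (of_nat j) * (P (Suc m) (j - 1) - P m (j - 1)) + of_bool (j = 0)))) $ n"
    proof (cases n)
      case 0
      then show ?thesis by (simp add: noshift)
    next
      case (Suc n')
      then show ?thesis
        by (cases n') (auto simp: noshift shift algebra_simps mult.assoc of_bool_def)
    qed
  qed
  then have "fps_const (P m j - fps_X * fps_const (x * of_nat (j + 1)) * P m j) =
     fps_const (fps_X * (fps_const x *
     (fps_const (of_nat j) * (P (Suc m) (j - 1) - P m (j - 1)) + of_bool (j = 0))))"
    by simp
  moreover have "type_gf m j = fps_const (P m j)" for m j
    by (simp add: type_gf_def P_def)
  moreover have "var_x + of_nat m = fps_const (fps_const x)"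
    by (simp add: var_x_def x_def fps_of_nat[symmetric])
  ultimately show ?thesis
    unfolding denom_def var_t_def
    by (simp add: algebra_simps of_bool_def flip: fps_of_nat fps_const_mult fps_const_add fps_const_sub)
qed

text \<open>The binomial transform of \<open>altsum\<close> satisfies the recurrence of
  \<open>type_gf\<close>, and the nonzero \<open>denom\<close> cancels. The induction treats all
  shifts at once since the recurrence passes from \<open>m\<close> to \<open>Suc m\<close>.\<close>

lemma type_gf_eq_sum: "type_gf m j = (\<Sum>k=0..j. of_nat (j choose k) * altsum m k)"
proof (induction j arbitrary: m)
  case 0
  have "type_gf m 0 * denom m 1 = altsum m 0 * denom m 1"
    using type_gf_eq[of m 0] altsum_eq[of m 0] by simp
  then show ?case by simp
next
  case (Suc j)
  let ?S = "\<lambda>m j. \<Sum>k=0..j. of_nat (j choose k) * altsum m k"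
  let ?xt = "(var_x + of_nat m) * var_t"
  have "denom m (a + b) = denom m a - ?xt * of_nat b" for a b
    by (simp add: denom_def algebra_simps)
  \<comment> \<open>Relates the denominator that belongs to \<open>altsum m k\<close> to the common
    one of the transform.\<close>
  then have d: "denom m (Suc j + 1) = denom m (k + 1) - ?xt * of_nat (Suc j - k)" if "k \<le> Suc j" for k
    using that by (metis add.commute add.left_commute le_add_diff_inverse)
  \<comment> \<open>Absorption turns the correction from \<open>d\<close> into a multiple of the
    transform of order \<open>j\<close>.\<close>
  have c: "of_nat (Suc j choose k) * of_nat (Suc j - k) = (of_nat (Suc j) * of_nat (j choose k) :: fps_xty)"
    if "k \<le> Suc j" for k
    using binomial_absorb_comp[of "Suc j" k]
    by (metis diff_Suc_1 mult.commute of_nat_mult)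
  have "?S m (Suc j) * denom m (Suc j + 1) =
     (\<Sum>k=0..Suc j. of_nat (Suc j choose k) * (altsum m k * denom m (k + 1))
         - ?xt * (of_nat (Suc j) * (of_nat (j choose k) * altsum m k)))"
    unfolding sum_distrib_right
  proof (rule sum.cong[OF refl])
    fix k assume "k \<in> {0..Suc j}"
    then have k: "k \<le> Suc j" by simp
    show "of_nat (Suc j choose k) * altsum m k * denom m (Suc j + 1) =
         of_nat (Suc j choose k) * (altsum m k * denom m (k + 1))
         - ?xt * (of_nat (Suc j) * (of_nat (j choose k) * altsum m k))"
      using arg_cong[OF c[OF k], of "\<lambda>z. z * (?xt * altsum m k)"]
      unfolding d[OF k] by (simp only: algebra_simps)
  qed
  also have "\<dots> = (\<Sum>k=0..Suc j. of_nat (Suc j choose k) * (altsum m k * denom m (k + 1)))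
      - ?xt * (of_nat (Suc j) * ?S m j)"
    by (simp add: sum_subtractf sum_distrib_left)
  also have "(\<Sum>k=0..Suc j. of_nat (Suc j choose k) * (altsum m k * denom m (k + 1))) =
      (\<Sum>k=0..Suc j. ?xt * (of_nat (k * (Suc j choose k)) * altsum (Suc m) (k - 1)
         + of_nat (Suc j choose k) * (-1) ^ k))"
    unfolding altsum_eq by (simp add: algebra_simps)
  also have "\<dots> = ?xt * ((\<Sum>k=0..Suc j. of_nat (k * (Suc j choose k)) * altsum (Suc m) (k - 1))
         + (\<Sum>k\<le>Suc j. (-1) ^ k * of_nat (Suc j choose k)))"
    by (simp only: sum_distrib_left[symmetric] sum.distrib atMost_atLeast0 mult.commute)
  \<comment> \<open>The signs \<open>(-1) ^ k\<close> contribute nothing because the order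
    \<open>Suc j\<close> is positive.\<close>
  also have "(\<Sum>k\<le>Suc j. (-1) ^ k * of_nat (Suc j choose k)) = (0 :: fps_xty)"
    by (rule choose_alternating_sum) simp
  \<comment> \<open>The term \<open>k = 0\<close> vanishes, and absorbing \<open>k\<close> into the
    binomial coefficient leaves the transform of order \<open>j\<close> at shift
    \<open>Suc m\<close>.\<close>
  also have "(\<Sum>k=0..Suc j. of_nat (k * (Suc j choose k)) * altsum (Suc m) (k - 1)) =
      of_nat (Suc j) * ?S (Suc m) j"
    by (simp only: sum.atLeast0_atMost_Suc_shift o_def Suc_times_binomial)
       (simp add: sum_distrib_left mult.assoc del: of_nat_Suc mult_Suc)
  finally have "?S m (Suc j) * denom m (Suc j + 1) =
     ?xt * (of_nat (Suc j) * (?S (Suc m) j - ?S m j))"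
    by (simp only: algebra_simps) simp
  then have "?S m (Suc j) * denom m (Suc j + 1) = type_gf m (Suc j) * denom m (Suc j + 1)"
    unfolding type_gf_eq by (simp add: Suc.IH)
  then show ?case by simp
qed

section \<open>Coefficients of \<open>alpha\<close>\<close>

lemma sums_fps_X_power: "(\<lambda>j. fps_X ^ j * fps_const (f $ j)) sums (f :: 'a::comm_ring_1 fps)"
  using fps_notation[of f] LIMSEQ_imp_Suc
  by (simp add: sums_def' mult.commute)

lemma finite_descent_perms [simp]: "finite (descent_perms n R)"
  by (rule finite_subset[OF _ finite_permutations[of "{1..n}"]]) (auto simp: descent_perms_def)

lemma largest_maximal_representation_iff_code:
  "largest_maximal_representation n (tournament_of n \<pi> p) \<pi> p \<longleftrightarrow>
     p \<in> parent_functions n \<and> \<pi> \<in> descent_perms n (parents n p)"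
  unfolding largest_maximal_representation_iff parent_functions_def descent_perms_def parents_def
  by blast

text \<open>Uniqueness of the representation makes the map from pairs to tournaments injective, and
  its image is the set of tournaments of the given type. The permutations are then summed out into
  \<open>weight\<close>.\<close>

lemma type_number_eq_sum:
  assumes "n > 0"
  shows "type_number n i j =
     (\<Sum>p | p \<in> parent_functions n \<and> card (parents n p) = j \<and> card (roots n p) = i.
        weight n (parents n p))"
proof -
  let ?Q = "{p. p \<in> parent_functions n \<and> card (parents n p) = j \<and> card (roots n p) = i}"
  let ?C = "SIGMA p:?Q. descent_perms n (parents n p)"
  let ?f = "\<lambda>(p, \<pi>). tournament_of n \<pi> p"
  have inj: "inj_on ?f ?C"
  proof (rule inj_onI)
    fix c d assume c: "c \<in> ?C" and d: "d \<in> ?C" and eq: "?f c = ?f d"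
    obtain p \<pi> q \<sigma> where cd: "c = (p, \<pi>)" "d = (q, \<sigma>)" by (cases c, cases d)
    have "largest_maximal_representation n (tournament_of n \<pi> p) \<pi> p"
      "largest_maximal_representation n (tournament_of n \<sigma> q) \<sigma> q"
      using c d unfolding largest_maximal_representation_iff_code cd by simp_all
    moreover have "tournament_of n \<pi> p = tournament_of n \<sigma> q"
      using eq by (simp only: cd prod.case)
    ultimately have "\<pi> = \<sigma> \<and> p = q"
      using largest_maximal_representation_unique[of n "tournament_of n \<pi> p" \<pi> p \<sigma> q] by simp
    then show "c = d" by (simp add: cd)
  qed
  have image: "?f ` ?C = {T. tournament n T \<and> alternation_acyclic T \<and> has_type T n i j}"
  proof (intro equalityI subsetI)
    fix T assume "T \<in> ?f ` ?C"
    then obtain c where c: "c \<in> ?C" "T = ?f c" by (rule imageE)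
    obtain p \<pi> where c': "c = (p, \<pi>)" by (cases c)
    have T: "T = tournament_of n \<pi> p" using c(2) by (simp add: c')
    have p: "p \<in> parent_functions n" "card (parents n p) = j" "card (roots n p) = i"
      and \<pi>: "\<pi> \<in> descent_perms n (parents n p)"
      using c(1) by (simp_all add: c')
    have "largest_maximal_representation n T \<pi> p"
      unfolding T largest_maximal_representation_iff_code using p \<pi> by blast
    moreover have "card {u \<in> {1..n}. p u = \<infinity>} = i"
      using p(3) by (simp only: roots_def)
    moreover have "card (p ` {1..n}) = j + 1"
      using card_range[OF p(1) assms] p(2) by simp
    ultimately have "has_type T n i j"
      unfolding has_type_def by blast
    then show "T \<in> {T. tournament n T \<and> alternation_acyclic T \<and> has_type T n i j}"
      by (simp add: T tournament_tournament_of alternation_acyclic_tournament_of)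
  next
    fix T assume "T \<in> {T. tournament n T \<and> alternation_acyclic T \<and> has_type T n i j}"
    then obtain \<pi> p where rep: "largest_maximal_representation n T \<pi> p"
      and i: "card {u \<in> {1..n}. p u = \<infinity>} = i" and j: "card (p ` {1..n}) = j + 1"
      unfolding has_type_def by blast
    have T: "T = tournament_of n \<pi> p"
      using rep by (simp add: largest_maximal_representation_def)
    have p: "p \<in> parent_functions n" and \<pi>: "\<pi> \<in> descent_perms n (parents n p)"
      using rep unfolding T largest_maximal_representation_iff_code by blast+
    have "card (roots n p) = i"
      using i by (simp only: roots_def)
    moreover have "card (parents n p) = j"
      using card_range[OF p assms] j by simp
    ultimately have "(p, \<pi>) \<in> ?C" using p \<pi> by simp
    then show "T \<in> ?f ` ?C"
      by (rule rev_image_eqI) (simp add: T)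
  qed
  have "type_number n i j = card ?C"
    unfolding type_number_def image[symmetric] by (rule card_image[OF inj])
  also have "\<dots> = (\<Sum>p\<in>?Q. card (descent_perms n (parents n p)))"
    by (rule card_SigmaI) (simp_all add: finite_subset[OF _ finite_parent_functions])
  finally show ?thesis by (simp only: card_descent_perms)
qed

text \<open>The vertex \<open>n\<close> is always a root and all parents lie in
  \<open>{2..n}\<close>. Hence for \<open>n > 0\<close> the range restriction in
  \<open>alpha\<close> cuts off only zeros.\<close>

lemma type_number_eq_0:
  assumes "n > 0" and "\<not> (1 \<le> i \<and> i \<le> n \<and> j < n)"
  shows "type_number n i j = 0"
proof -
  have "1 \<le> card (roots n p) \<and> card (roots n p) \<le> n \<and> card (parents n p) < n"
    if p: "p \<in> parent_functions n" for p
  proof (intro conjI)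
    have "n \<in> roots n p"
      using parent_functions_last[OF p assms(1)] assms(1) by (simp add: roots_def)
    then show "1 \<le> card (roots n p)"
      by (metis One_nat_def Suc_leI card_gt_0_iff empty_iff finite_roots)
    show "card (roots n p) \<le> n"
      using card_mono[of "{1..n}" "roots n p"] by (simp add: roots_def subset_iff)
    show "card (parents n p) < n"
      using card_mono[OF _ parents_subset[OF p]] assms(1) by simp
  qed
  then have "{p. p \<in> parent_functions n \<and> card (parents n p) = j \<and> card (roots n p) = i} = {}"
    using assms(2) by blast
  then show ?thesis
    unfolding type_number_eq_sum[OF assms(1)] by (simp only: sum.empty)
qed

text \<open>At the series variable the powers \<open>x ^ card (roots n p)\<close> become monomials,
  so the coefficient at \<open>i\<close> selects the parent functions with \<open>i\<close>
  roots.\<close>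

lemma type_poly_nth:
  assumes "n > 0"
  shows "type_poly n j fps_X $ i = (of_nat (type_number n i j) :: 'a::comm_ring_1)"
proof -
  have "type_poly n j fps_X $ i =
      (\<Sum>p | p \<in> parent_functions n \<and> card (parents n p) = j.
        of_bool (card (roots n p) = i) * (of_nat (weight n (parents n p)) :: 'a))"
    unfolding code_poly_eq[symmetric] code_poly_def fps_sum_nth
    by (rule sum.cong) (auto simp: fps_of_nat[symmetric] simp del: fps_of_nat fps_const_mult)
  also have "\<dots> = of_nat (\<Sum>p | p \<in> parent_functions n \<and> card (parents n p) = j \<and> card (roots n p) = i.
        weight n (parents n p))"
    unfolding of_nat_sum by (rule sum.mono_neutral_cong_right) auto
  finally show ?thesis
    by (simp only: type_number_eq_sum[OF assms])
qed

lemma fps_xty_fact: "(fact j :: fps_xty) = fps_const (fps_const (fps_const (fact j)))"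
  by (metis fps_of_nat of_nat_fact)

lemma type_gf_eq_alpha: "type_gf 0 j = fact j * fps_const (alpha $ j)"
proof -
  have "(if n = 0 then 0 else type_poly n j fps_X) $ i = fact j * (alpha $ j $ n $ i)" for n i
    by (cases "n = 0") (simp_all add: alpha_def type_poly_nth type_number_eq_0)
  then have "Abs_fps (\<lambda>n. if n = 0 then 0 else type_poly n j fps_X) =
      fps_const (fps_const (fact j)) * (alpha $ j)"
    by (intro fps_ext) simp
  then have "fps_const (Abs_fps (\<lambda>n. if n = 0 then 0 else type_poly n j fps_X)) =
      fact j * fps_const (alpha $ j)"
    by (simp add: fps_xty_fact)
  then show ?thesis
    unfolding type_gf_def of_nat_0 add_0_right .
qed

unbundle no fps_syntax

theorem theorem8p1:
  "(\<lambda>j. var_y ^ j / fact j *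
      (\<Sum>k=0..j. of_nat (j choose k) * (1 / of_nat (k + 1)) *
        (\<Sum>i=0..k. (-1) ^ (k - i) *
          (\<Prod>l=0..i.
            (var_x + of_nat l) * of_nat (k + 1 - l) * var_t /
            (1 - (var_x + of_nat l) * of_nat (k + 1 - l) * var_t)))))
   sums alpha"
proof -
  \<comment> \<open>The factorial in \<open>type_gf_eq_alpha\<close> cancels, which leaves the
    \<open>j\<close>-th monomial of \<open>alpha\<close> in \<open>y\<close>.\<close>
  have "var_y ^ j / fact j * type_gf 0 j = fps_X ^ j * fps_const (fps_nth alpha j)" for j
  proof -
    have "var_y ^ j / fact j * fact j = var_y ^ j"
      by (rule fps_xty_divide) (simp add: fps_xty_fact)
    then show ?thesis
      by (simp only: type_gf_eq_alpha mult.assoc[symmetric] var_y_def)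
  qed
  then have "(\<lambda>j. var_y ^ j / fact j * type_gf 0 j) sums alpha"
    by (simp only: sums_fps_X_power)
  then show ?thesis
    by (simp only: type_gf_eq_sum altsum_def factor_def denom_def mult.assoc[symmetric] add_0)
qed

end
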